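(* Let $\boldsymbol\lambda,\boldsymbol\mu,\boldsymbol\nu\in\mathcal{P}(\Phi)$ with $\|\boldsymbol\nu\|=\|\boldsymbol\lambda\|+\|\boldsymbol\mu\|$. Then the structure constant $a^{\boldsymbol\nu}_{\boldsymbol\lambda\boldsymbol\mu}(n)$ (defined for all $n\ge \|\boldsymbol\nu\|+\ell(\boldsymbol\nu^e)$) is a nonnegative integer which is independent of $n$.
   Context: Let $q$ be a prime power, $\mathbb F_q$ the field with $q$ elements, and $G_n=GL_n(\mathbb F_q)$. For $m\le n$ regard $G_m\subset G_n$ via $g\mapsto \mathrm{diag}(g,I_{n-m})$. Let $\Phi$ be the set of monic irreducible polynomials in $\mathbb F_q[t]$ other than $t$, and $d(f)$ the degree of $f$. Let $\mathcal{P}(\Phi)$ be the set of maps $\boldsymbol\lambda$ from $\Phi$ to the set of integer partitions with $\boldsymbol\lambda(f)=\emptyset$ for all but finitely many $f$; put $\|\boldsymbol\lambda\|=\sum_f d(f)|\boldsymbol\lambda(f)|$, $\boldsymbol\lambda^e:=\boldsymbol\lambda(t-1)$, and let $\ell(\cdot)$ denote the number of nonzero parts of a partition. The type of $g\in G_n$ is the unique $\boldsymbol\lambda\in\mathcal{P}(\Phi)$ such that $\mathbb F_q^n$, viewed as an $\mathbb F_q[t]$-module with $t$ acting by $g$, is isomorphic to $\bigoplus_{f,i}\mathbb F_q[t]/(f^{\boldsymbol\lambda_i(f)})$, where $\boldsymbol\lambda(f)=(\boldsymbol\lambda_1(f),\boldsymbol\lambda_2(f),\dots)$. The modified type of $g$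 is $\mathring{\boldsymbol\lambda}\in\mathcal{P}(\Phi)$ with $\mathring{\boldsymbol\lambda}(f)=\boldsymbol\lambda(f)$ for $f\ne t-1$ and $\mathring{\boldsymbol\lambda}(t-1)=(\boldsymbol\lambda^e_1-1,\dots,\boldsymbol\lambda^e_r-1)$ (zero parts discarded), $r=\ell(\boldsymbol\lambda^e)$; it does not change under the embeddings $G_n\subset G_{n+m}$. Elements of $G_n$ of modified type $\boldsymbol\mu$ exist iff $\|\boldsymbol\mu\|+\ell(\boldsymbol\mu^e)\le n$, and then they form one conjugacy class. Let $K_{\boldsymbol\mu}(n)\in\mathbb Z[G_n]$ be the sum of all elements of $G_n$ of modified type $\boldsymbol\mu$ (zero if there are none). The nonzero $K_{\boldsymbol\mu}(n)$ form a $\mathbb Z$-basis of the center of $\mathbb Z[G_n]$, and the structure constants $a^{\boldsymbol\nu}_{\boldsymbol\lambda\boldsymbol\mu}(n)$, for $\boldsymbol\nu$ with $\|\boldsymbol\nu\|+\ell(\boldsymbol\nu^e)\le n$, are defined by $K_{\boldsymbol\lambda}(n)K_{\boldsymbol\mu}(n)=\sum_{\boldsymbol\nu}a^{\boldsymbol\nu}_{\boldsymbol\lambda\boldsymbol\mu}(n)K_{\boldsymbol\nu}(n)$. *)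

theory Defs
  imports "Jordan_Normal_Form.Determinant" "HOL-Computational_Algebra.Polynomial_Factorial"
begin

text \<open>The finite field F_q is modelled by a type variable 'a of class finite and field.
  n x n matrices are JNF matrices in carrier_mat n n.\<close>

definition GL :: "nat \<Rightarrow> 'a::field mat set" where
  "GL n = {A. A \<in> carrier_mat n n \<and> det A \<noteq> 0}"

definition Phi :: "'a::field poly set" where
  "Phi = {f. lead_coeff f = 1 \<and> irreducible f \<and> f \<noteq> [:0, 1:]}"

definition is_partition :: "nat list \<Rightarrow> bool" where
  "is_partition xs \<longleftrightarrow> sorted_wrt (\<ge>) xs \<and> (\<forall>x\<in>set xs. 0 < x)"

definition PPhi :: "('a::field poly \<Rightarrow> nat list) set" where
  "PPhi = {lam. (\<forall>f. is_partition (lam f)) \<and> (\<forall>f. lam f \<noteq> [] \<longrightarrow> f \<in> Phi)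
               \<and> finite {f. lam f \<noteq> []}}"

definition pnorm :: "('a::field poly \<Rightarrow> nat list) \<Rightarrow> nat" where
  "pnorm lam = (\<Sum>f\<in>{f. lam f \<noteq> []}. degree f * sum_list (lam f))"

definition epart :: "('a::field poly \<Rightarrow> nat list) \<Rightarrow> nat list" where
  "epart lam = lam [:-1, 1:]"

text \<open>Companion matrix of a monic polynomial p of degree d: the matrix of multiplication by t
  on F[t]/(p) in the basis 1, t, ..., t^(d-1).\<close>
definition companion_mat :: "'a::field poly \<Rightarrow> 'a mat" where
  "companion_mat p = (let d = degree p in
     mat d d (\<lambda>(i, j). if j = d - 1 then - coeff p i else if i = j + 1 then 1 else 0))"

text \<open>g has type lam: F^n with t acting by g is isomorphic, as F[t]-module, to the direct sum of
  F[t]/(f^(lam_i(f))); equivalently g is similar to the block diagonal matrix of the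
  corresponding companion matrices (blocks in any order).\<close>
definition has_type :: "'a::field mat \<Rightarrow> ('a poly \<Rightarrow> nat list) \<Rightarrow> bool" where
  "has_type g lam \<longleftrightarrow> lam \<in> PPhi \<and>
     (\<exists>bs. mset bs = (\<Sum>f\<in>{f. lam f \<noteq> []}. mset (map (\<lambda>k. (f, k)) (lam f))) \<and>
           similar_mat g (diag_block_mat (map (\<lambda>(f, k). companion_mat (f ^ k)) bs)))"

definition modify :: "('a::field poly \<Rightarrow> nat list) \<Rightarrow> ('a poly \<Rightarrow> nat list)" where
  "modify lam = (\<lambda>f. if f = [:-1, 1:] then filter (\<lambda>x. 0 < x) (map (\<lambda>x. x - 1) (lam f))
                     else lam f)"

definition has_modtype :: "'a::field mat \<Rightarrow> ('a poly \<Rightarrow> nat list) \<Rightarrow> bool" where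
  "has_modtype g mu \<longleftrightarrow> (\<exists>lam. has_type g lam \<and> modify lam = mu)"

text \<open>Elements of Z[G_n] as functions G_n -> int; the class sum K_mu(n).\<close>
definition class_sum :: "('a::field poly \<Rightarrow> nat list) \<Rightarrow> nat \<Rightarrow> 'a mat \<Rightarrow> int" where
  "class_sum mu n = (\<lambda>g. if g \<in> GL n \<and> has_modtype g mu then 1 else 0)"

definition gr_mult :: "nat \<Rightarrow> ('a::field mat \<Rightarrow> int) \<Rightarrow> ('a mat \<Rightarrow> int) \<Rightarrow> 'a mat \<Rightarrow> int" where
  "gr_mult n X Y = (\<lambda>z. \<Sum>(x, y)\<in>{(x, y). x \<in> GL n \<and> y \<in> GL n \<and> x * y = z}. X x * Y y)"

text \<open>Structure constant a^nu_{lam mu}(n): the coefficient of K_nu(n) in K_lam(n) K_mu(n),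
  i.e. the value of the (central) product at an element of modified type nu.\<close>
definition struct_const ::
  "('a::field poly \<Rightarrow> nat list) \<Rightarrow> ('a poly \<Rightarrow> nat list) \<Rightarrow> ('a poly \<Rightarrow> nat list) \<Rightarrow> nat \<Rightarrow> int" where
  "struct_const lam mu nu n =
     gr_mult n (class_sum lam n) (class_sum mu n) (SOME z. z \<in> GL n \<and> has_modtype z nu)"

end

theory Submission
  imports Defs "HOL-Library.Cardinality"
begin

text \<open>An element of modified type \<open>mu\<close> has fixed space of codimension \<open>pnorm mu\<close>. If the norms add
  up, \<open>x y = z\<close> therefore forces \<open>Fix z = Fix x \<inter> Fix y\<close>, and likewise for the transposes. For
  \<open>z = z\<^sub>0 \<oplus> 1\<close> this means that the last basis vector and the last coordinate functional are fixed by
  \<open>x\<close> and \<open>y\<close>, that is \<open>x = x\<^sub>0 \<oplus> 1\<close> and \<open>y = y\<^sub>0 \<oplus> 1\<close>: the factorizations of \<open>z\<close> in \<open>GL (n + 1)\<close>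
  are those of \<open>z\<^sub>0\<close> in \<open>GL n\<close>. That \<open>x\<^sub>0\<close> has the modified type of \<open>x\<^sub>0 \<oplus> 1\<close> follows by cancelling
  the summand \<open>1\<close>: if all Jordan blocks of \<open>x\<^sub>0 \<oplus> 1\<close> for the eigenvalue 1 had size at least 2, fixed vectors
  would be annihilated by fixed covectors, so one of these blocks has size 1.\<close>

section \<open>Direct sums of matrices and similarity\<close>

text \<open>Dimensions are handled as cardinalities: over a field with \<open>q\<close> elements a
  fixed space of dimension \<open>k\<close> has \<open>q ^ k\<close> elements, so a statement about
  codimensions becomes an identity between powers of \<open>CARD('a)\<close>. In this form the
  argument rests on two facts. The set Fix x \<inter> Fix y always lies in Fix (x y), and its
  codimension is at most the sum of the codimensions of Fix x and Fix y. Transposes enter because a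
  fixed last basis vector determines only the last column of a matrix; the last row comes from the
  fixed covector. The obstacle is that a type is known only up to similarity. That x = x0 \<oplus> 1
  is similar to a block matrix does not by itself exhibit a trivial block on the other side. Hence a
  similarity-invariant test for such a block is needed, valid in every characteristic, and then a
  cancellation theorem for similarity. Finally, \<open>struct_const\<close> evaluates the product at
  an arbitrarily chosen element for each \<open>n\<close>. These choices are unrelated, so
  conjugation invariance is needed before the values at \<open>n\<close> and \<open>n + 1\<close>
  can be compared.\<close>

definition dsum :: "'a::zero mat \<Rightarrow> 'a mat \<Rightarrow> 'a mat" where
  "dsum A B = four_block_mat A (0\<^sub>m (dim_row A) (dim_col B)) (0\<^sub>m (dim_row B) (dim_col A)) B"

lemma diag_block_mat_Cons_dsum: "diag_block_mat (A # As) = dsum A (diag_block_mat As)"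
  by (simp add: dsum_def Let_def)

lemma diag_block_mat_append_dsum:
  "diag_block_mat (As @ Bs) = dsum (diag_block_mat As) (diag_block_mat Bs)"
  by (simp add: dsum_def diag_block_mat_append Let_def)

lemma dsum_assoc: "dsum A (dsum B C) = dsum (dsum A B) C"
  unfolding dsum_def by (rule assoc_four_block_mat)

lemma dsum_carrier: "A \<in> carrier_mat n n \<Longrightarrow> B \<in> carrier_mat m m \<Longrightarrow> dsum A B \<in> carrier_mat (n + m) (n + m)"
  by (auto simp: dsum_def)

lemma dim_dsum [simp]:
  "dim_row (dsum A B) = dim_row A + dim_row B" "dim_col (dsum A B) = dim_col A + dim_col B"
  by (auto simp: dsum_def)

lemma transpose_dsum:
  fixes A B :: "'a::zero mat"
  assumes "A \<in> carrier_mat n n" "B \<in> carrier_mat m m"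
  shows "transpose_mat (dsum A B) = dsum (transpose_mat A) (transpose_mat B)"
  unfolding dsum_def by (rule eq_matI) (use assms in auto)

lemma dsum_mult:
  fixes A B C D :: "'a::semiring_0 mat"
  assumes "A \<in> carrier_mat n n" "B \<in> carrier_mat m m" "C \<in> carrier_mat n n" "D \<in> carrier_mat m m"
  shows "dsum A B * dsum C D = dsum (A * C) (B * D)"
proof -
  have "dsum A B * dsum C D = four_block_mat (A * C + 0\<^sub>m n m * 0\<^sub>m m n) (A * 0\<^sub>m n m + 0\<^sub>m n m * D)
      (0\<^sub>m m n * C + B * 0\<^sub>m m n) (0\<^sub>m m n * 0\<^sub>m n m + B * D)"
    unfolding dsum_def using assms
    by (subst mult_four_block_mat[of _ n n _ m _ m _ _ n _ m]) auto
  then show ?thesis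
    using assms by (simp add: dsum_def)
qed

lemma dsum_mult_vec:
  fixes A B :: "'a::comm_semiring_1 mat"
  assumes "A \<in> carrier_mat n n" "B \<in> carrier_mat m m" "u \<in> carrier_vec n" "v \<in> carrier_vec m"
  shows "dsum A B *\<^sub>v (u @\<^sub>v v) = (A *\<^sub>v u) @\<^sub>v (B *\<^sub>v v)"
  using mult_mat_vec_split[OF assms] assms by (simp add: dsum_def)

lemma four_block_mat_inject:
  assumes "four_block_mat A B C D = four_block_mat A' B' C' D'"
    and "A \<in> carrier_mat n1 m1" "B \<in> carrier_mat n1 m2" "C \<in> carrier_mat n2 m1" "D \<in> carrier_mat n2 m2"
    and "A' \<in> carrier_mat n1 m1" "B' \<in> carrier_mat n1 m2" "C' \<in> carrier_mat n2 m1" "D' \<in> carrier_mat n2 m2"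
  shows "A = A'" "B = B'" "C = C'" "D = D'"
proof -
  have *: "four_block_mat A B C D $$ (i, j) = four_block_mat A' B' C' D' $$ (i, j)" for i j
    using assms(1) by simp
  show "A = A'"
  proof (rule eq_matI)
    fix i j assume "i < dim_row A'" "j < dim_col A'"
    then show "A $$ (i, j) = A' $$ (i, j)" using *[of i j] assms(2-) by simp
  qed (use assms(2-) in auto)
  show "B = B'"
  proof (rule eq_matI)
    fix i j assume "i < dim_row B'" "j < dim_col B'"
    then show "B $$ (i, j) = B' $$ (i, j)" using *[of i "m1 + j"] assms(2-) by simp
  qed (use assms(2-) in auto)
  show "C = C'"
  proof (rule eq_matI)
    fix i j assume "i < dim_row C'" "j < dim_col C'"
    then show "C $$ (i, j) = C' $$ (i, j)" using *[of "n1 + i" j] assms(2-) by simp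
  qed (use assms(2-) in auto)
  show "D = D'"
  proof (rule eq_matI)
    fix i j assume "i < dim_row D'" "j < dim_col D'"
    then show "D $$ (i, j) = D' $$ (i, j)" using *[of "n1 + i" "m1 + j"] assms(2-) by simp
  qed (use assms(2-) in auto)
qed

lemma dsum_inject:
  assumes "dsum A B = dsum A' B'" "A \<in> carrier_mat n n" "A' \<in> carrier_mat n n"
    "B \<in> carrier_mat m m" "B' \<in> carrier_mat m m"
  shows "A = A'"
  using assms four_block_mat_inject(1)[OF assms(1)[unfolded dsum_def], of n n m m] by auto

lemma det_dsum:
  fixes A B :: "'a::idom mat"
  assumes "A \<in> carrier_mat n n" "B \<in> carrier_mat m m"
  shows "det (dsum A B) = det A * det B"
  unfolding dsum_def using assms
  by (intro det_four_block_mat_lower_left_zero[of _ n _ m]) auto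

lemma GL_dsum_one: "dsum A (1\<^sub>m 1) \<in> GL (Suc n) \<longleftrightarrow> A \<in> GL n" if "A \<in> carrier_mat n n"
  using that dsum_carrier[OF that, of "1\<^sub>m 1" 1] det_dsum[OF that, of "1\<^sub>m 1" 1]
  by (simp add: GL_def)

lemma similar_mat_dsum:
  assumes "similar_mat A A'" "similar_mat B B'" "A \<in> carrier_mat n n" "B \<in> carrier_mat m m"
  shows "similar_mat (dsum A B) (dsum A' B')"
proof -
  have "A' \<in> carrier_mat n n" "B' \<in> carrier_mat m m"
    using similar_matD[OF assms(1)] similar_matD[OF assms(2)] assms(3,4) by auto
  then show ?thesis
    using similar_mat_four_block_0_0[OF assms] assms(3,4) by (simp add: dsum_def)
qed

lemma similar_mat_dsum_commute:
  fixes A B :: "'a::semiring_1 mat"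
  assumes A: "A \<in> carrier_mat n n" and B: "B \<in> carrier_mat m m"
  shows "similar_mat (dsum A B) (dsum B A)"
proof -
  \<comment> \<open>\<open>P\<close> and \<open>Q\<close> are the block permutation matrices that
    exchange the two summands of the coordinate space.\<close>
  define P where "P = four_block_mat (0\<^sub>m n m) (1\<^sub>m n) (1\<^sub>m m) (0\<^sub>m m n :: 'a mat)"
  define Q where "Q = four_block_mat (0\<^sub>m m n) (1\<^sub>m m) (1\<^sub>m n) (0\<^sub>m n m :: 'a mat)"
  have carr: "{dsum A B, dsum B A, P, Q} \<subseteq> carrier_mat (n + m) (n + m)"
    using dsum_carrier[OF A B] dsum_carrier[OF B A] by (auto simp: P_def Q_def add.commute)
  have PQ: "P * Q = 1\<^sub>m (n + m)"
    unfolding P_def Q_def by (subst mult_four_block_mat[of _ n m _ n _ m _ _ n _ m]) auto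
  have QP: "Q * P = 1\<^sub>m (n + m)"
    unfolding P_def Q_def
    by (subst mult_four_block_mat[of _ m n _ m _ n _ _ m _ n]) (auto simp: add.commute)
  have "P * dsum B A = four_block_mat (0\<^sub>m n m) A B (0\<^sub>m m n)"
    unfolding P_def dsum_def using A B
    by (subst mult_four_block_mat[of _ n m _ n _ m _ _ m _ n]) auto
  also have "\<dots> * Q = dsum A B"
    unfolding Q_def dsum_def using A B
    by (subst mult_four_block_mat[of _ n m _ n _ m _ _ n _ m]) auto
  finally have "dsum A B = P * dsum B A * Q" by simp
  with carr PQ QP show ?thesis by (rule similar_matI)
qed

lemma square_diag_block_mat:
  "\<forall>A\<in>set As. square_mat A \<Longrightarrow> \<exists>n. diag_block_mat As \<in> carrier_mat n n"
  using diag_block_mat_square[of As] by (auto simp: square_mat.simps)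

text \<open>A type prescribes only a multiset of blocks. Adjacent summands commute up to similarity,
  so the head of one list can be moved past the blocks preceding it in the other list.\<close>

lemma similar_diag_block_mat_perm:
  fixes As Bs :: "'a::semiring_1 mat list"
  assumes "mset As = mset Bs" "\<forall>A\<in>set As. square_mat A"
  shows "similar_mat (diag_block_mat As) (diag_block_mat Bs)"
  using assms
proof (induction As arbitrary: Bs)
  case Nil
  then show ?case by (simp add: similar_mat_refl[of _ 0])
next
  case (Cons A As)
  from Cons.prems(1) have "A \<in> set Bs" by (metis list.set_intros(1) set_mset_mset)
  then obtain B1 B2 where Bs: "Bs = B1 @ A # B2" by (meson split_list)
  have ms: "mset As = mset (B1 @ B2)" using Cons.prems(1) Bs by simp
  have sq: "\<forall>A\<in>set As. square_mat A" "square_mat A" using Cons.prems by auto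
  from mset_eq_setD[OF ms] have st: "set As = set B1 \<union> set B2" by simp
  then have sqB: "\<forall>A\<in>set B1. square_mat A" "\<forall>A\<in>set B2. square_mat A" using sq by auto
  obtain n where n: "diag_block_mat As \<in> carrier_mat n n" using square_diag_block_mat sq by blast
  obtain m where m: "A \<in> carrier_mat m m" using sq by (auto simp: square_mat.simps)
  obtain n1 where n1: "diag_block_mat B1 \<in> carrier_mat n1 n1" using square_diag_block_mat sqB by blast
  obtain n2 where n2: "diag_block_mat B2 \<in> carrier_mat n2 n2" using square_diag_block_mat sqB by blast
  have "similar_mat (diag_block_mat (A # As)) (dsum A (diag_block_mat (B1 @ B2)))"
    unfolding diag_block_mat_Cons_dsum
    by (rule similar_mat_dsum[OF similar_mat_refl[OF m] Cons.IH[OF ms sq(1)] m n])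
  also have "dsum A (diag_block_mat (B1 @ B2)) = dsum (dsum A (diag_block_mat B1)) (diag_block_mat B2)"
    by (simp add: diag_block_mat_append_dsum dsum_assoc)
  finally have 1: "similar_mat (diag_block_mat (A # As)) \<dots>" .
  have "similar_mat (dsum (dsum A (diag_block_mat B1)) (diag_block_mat B2))
      (dsum (dsum (diag_block_mat B1) A) (diag_block_mat B2))"
    by (rule similar_mat_dsum[OF similar_mat_dsum_commute[OF m n1] similar_mat_refl[OF n2] dsum_carrier[OF m n1] n2])
  also have "dsum (dsum (diag_block_mat B1) A) (diag_block_mat B2) = diag_block_mat Bs"
    unfolding Bs diag_block_mat_append_dsum diag_block_mat_Cons_dsum dsum_assoc ..
  finally show ?case using 1 by (rule similar_mat_trans[rotated])
qed

lemma similar_mat_transpose: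
  fixes A B :: "'a::comm_semiring_1 mat"
  assumes "similar_mat A B"
  shows "similar_mat (transpose_mat A) (transpose_mat B)"
proof -
  obtain n P Q where *: "{A, B, P, Q} \<subseteq> carrier_mat n n" "P * Q = 1\<^sub>m n" "Q * P = 1\<^sub>m n" "A = P * B * Q"
    using similar_matD[OF assms] by blast
  have t: "transpose_mat (X * Y) = transpose_mat Y * transpose_mat X"
    if "X \<in> carrier_mat n n" "Y \<in> carrier_mat n n" for X Y :: "'a mat"
    using that by (simp add: transpose_mult)
  have B: "B \<in> carrier_mat n n" and P: "P \<in> carrier_mat n n" and Q: "Q \<in> carrier_mat n n"
    using * by auto
  have eq: "transpose_mat A = transpose_mat Q * transpose_mat B * transpose_mat P"
    unfolding *(4) using B P Q by (simp add: t assoc_mult_mat[of _ n n _ n _ n])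
  have "transpose_mat Q * transpose_mat P = 1\<^sub>m n" "transpose_mat P * transpose_mat Q = 1\<^sub>m n"
    unfolding t[OF P Q, symmetric] t[OF Q P, symmetric] *(2,3) by simp_all
  then show ?thesis
    using *(1) by (intro similar_matI[OF _ _ _ eq]) auto
qed

lemma similar_matI_intertwine:
  fixes A B T :: "'a::field mat"
  assumes "A \<in> carrier_mat n n" "B \<in> carrier_mat n n" "T \<in> carrier_mat n n"
    and "det T \<noteq> 0" "T * A = B * T"
  shows "similar_mat A B"
proof -
  obtain S where S: "S \<in> carrier_mat n n" "S * T = 1\<^sub>m n" "T * S = 1\<^sub>m n"
    using det_non_zero_imp_unit[OF assms(3,4), of "()"] by (auto simp: Units_def ring_mat_def)
  have "A = S * T * A" using assms S by simp
  also have "\<dots> = S * (B * T)"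
    using assms(1,3) S(1) by (simp add: assms(5)[symmetric] assoc_mult_mat[of _ n n _ n _ n])
  also have "\<dots> = S * B * T"
    using assms(2,3) S(1) by (simp add: assoc_mult_mat[of _ n n _ n _ n])
  finally have eq: "A = S * B * T" .
  show ?thesis
    using assms(1,2,3) S(1) by (intro similar_matI[OF _ S(2,3) eq]) auto
qed

text \<open>\<open>A\<close> and \<open>c\<close> form the first block column, so \<open>u\<close>
  padded with zeros lies in the kernel of the whole invertible matrix. Applied to the transpose,
  \<open>b\<close> takes the role of \<open>c\<close>.\<close>

lemma four_block_mat_kernel_left:
  fixes A :: "'a::idom mat"
  assumes "A \<in> carrier_mat n n" "b \<in> carrier_mat n m" "c \<in> carrier_mat m n" "d \<in> carrier_mat m m"
    and det: "det (four_block_mat A b c d) \<noteq> 0"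
    and u: "u \<in> carrier_vec n" "A *\<^sub>v u = 0\<^sub>v n" "c *\<^sub>v u = 0\<^sub>v m"
  shows "u = 0\<^sub>v n"
proof -
  let ?Q = "four_block_mat A b c d"
  have Q: "?Q \<in> carrier_mat (n + m) (n + m)" using assms(1,4) by simp
  have "b *\<^sub>v 0\<^sub>v m = 0\<^sub>v n" "d *\<^sub>v 0\<^sub>v m = 0\<^sub>v m"
    using assms(2,4) by (auto intro!: eq_vecI)
  then have "?Q *\<^sub>v (u @\<^sub>v 0\<^sub>v m) = 0\<^sub>v n @\<^sub>v 0\<^sub>v m"
    using four_block_mat_mult_vec[OF assms(1-4) u(1), of "0\<^sub>v m"] u by simp
  also have "\<dots> = 0\<^sub>v (n + m)" by auto
  finally have "u @\<^sub>v 0\<^sub>v m = 0\<^sub>v (n + m)"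
    using det det_0_iff_vec_prod_zero[OF Q] append_carrier_vec[OF u(1), of "0\<^sub>v m" m] by auto
  also have "\<dots> = 0\<^sub>v n @\<^sub>v 0\<^sub>v m" by auto
  finally show ?thesis using append_vec_eq[OF u(1), of "0\<^sub>v n"] by simp
qed

text \<open>With an intertwiner \<open>Q\<close> having blocks \<open>A, b, c, d\<close>, both \<open>A\<close> and \<open>A + b c\<close> intertwine
  \<open>X\<close> and \<open>M\<close>; at least one of them is invertible because \<open>Q\<close> is.\<close>
lemma similar_mat_dsum_one_cancel:
  fixes X M :: "'a::field mat"
  assumes X: "X \<in> carrier_mat n n" and M: "M \<in> carrier_mat n n"
    and sim: "similar_mat (dsum X (1\<^sub>m 1)) (dsum M (1\<^sub>m 1))"
  shows "similar_mat X M"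
proof -
  let ?N = "n + 1"
  have X1: "dsum X (1\<^sub>m 1) \<in> carrier_mat ?N ?N" and M1: "dsum M (1\<^sub>m 1) \<in> carrier_mat ?N ?N"
    using X M by (auto simp del: One_nat_def intro!: dsum_carrier)
  obtain P Q where wit: "similar_mat_wit (dsum X (1\<^sub>m 1)) (dsum M (1\<^sub>m 1)) P Q"
    using sim unfolding similar_mat_def by blast
  note PQ = similar_mat_witD2(6,7,1,2,3)[OF X1 wit]
  have "Q * dsum X (1\<^sub>m 1) = Q * P * dsum M (1\<^sub>m 1) * Q"
    unfolding PQ(5) using PQ(1,2) M1 by (simp add: assoc_mult_mat[of _ ?N ?N _ ?N _ ?N])
  then have int: "Q * dsum X (1\<^sub>m 1) = dsum M (1\<^sub>m 1) * Q"
    unfolding PQ(4) left_mult_one_mat[OF M1] .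
  obtain A b c d where sb: "split_block Q n n = (A, b, c, d)" by (rule prod_cases4)
  from split_block[OF sb, of 1 1] PQ(2)
  have blk: "A \<in> carrier_mat n n" "b \<in> carrier_mat n 1" "c \<in> carrier_mat 1 n" "d \<in> carrier_mat 1 1"
    and Q: "Q = four_block_mat A b c d" by auto
  have "Q * dsum X (1\<^sub>m 1) = four_block_mat (A * X) b (c * X) d"
    unfolding Q dsum_def using blk X
    by (subst mult_four_block_mat[of _ n n _ 1 _ 1 _ _ n _ 1]) auto
  moreover have "dsum M (1\<^sub>m 1) * Q = four_block_mat (M * A) (M * b) c d"
    unfolding Q dsum_def using blk M
    by (subst mult_four_block_mat[of _ n n _ 1 _ 1 _ _ n _ 1]) auto
  ultimately have eq: "four_block_mat (A * X) b (c * X) d = four_block_mat (M * A) (M * b) c d"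
    using int by simp
  note inj = four_block_mat_inject[OF eq, of n n 1 1]
  \<comment> \<open>The off-diagonal blocks consist of a fixed vector \<open>b\<close> of
    \<open>M\<close> and a fixed covector \<open>c\<close> of \<open>X\<close>; this is why
    \<open>b * c\<close> is an intertwiner as well.\<close>
  have AX: "A * X = M * A" and b: "M * b = b" and c: "c * X = c"
    using inj X M blk by (auto simp del: One_nat_def)
  show ?thesis
  proof (cases "det A = 0")
    case False
    then show ?thesis using similar_matI_intertwine[OF X M blk(1)] AX by blast
  next
    case True
    let ?T = "A + b * c"
    have T: "?T \<in> carrier_mat n n" using blk by auto
    have "?T * X = A * X + b * (c * X)"
      using blk X by (simp add: add_mult_distrib_mat[of _ n n] assoc_mult_mat[of _ n 1 _ n _ n])
    also have "\<dots> = M * A + M * b * c" using AX b c by simp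
    also have "\<dots> = M * ?T"
      using blk M by (simp add: mult_add_distrib_mat[of _ n n] assoc_mult_mat[of _ n n _ 1 _ n])
    finally have TX: "?T * X = M * ?T" .
    have detQ: "det Q \<noteq> 0" using det_mult[OF PQ(1,2)] PQ(3) by auto
    have inj: "u = 0\<^sub>v n" if "u \<in> carrier_vec n" "A *\<^sub>v u = 0\<^sub>v n" "c *\<^sub>v u = 0\<^sub>v 1" for u
      by (rule four_block_mat_kernel_left[OF blk detQ[unfolded Q] that])
    have detQt: "det (transpose_mat Q) \<noteq> 0" using detQ det_transpose[OF PQ(2)] by simp
    have Qt: "transpose_mat Q = four_block_mat (transpose_mat A) (transpose_mat c) (transpose_mat b) (transpose_mat d)"
      unfolding Q by (rule transpose_four_block_mat) (use blk in auto)
    \<comment> \<open>A covector \<open>w\<close> killing \<open>A\<close> cannot kill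
      \<open>b\<close> too, since the first block row of the invertible \<open>Q\<close> would then
      be degenerate.\<close>
    obtain w where w: "w \<in> carrier_vec n" "w \<noteq> 0\<^sub>v n" "transpose_mat A *\<^sub>v w = 0\<^sub>v n"
      using True det_transpose[OF blk(1)] det_0_iff_vec_prod_zero[of "transpose_mat A" n] blk(1) by auto
    have wb: "transpose_mat b *\<^sub>v w \<noteq> 0\<^sub>v 1"
    proof
      assume *: "transpose_mat b *\<^sub>v w = 0\<^sub>v 1"
      have "w = 0\<^sub>v n"
        by (rule four_block_mat_kernel_left[OF _ _ _ _ detQt[unfolded Qt] w(1,3) *]) (use blk in auto)
      with w(2) show False by blast
    qed
    \<comment> \<open>If \<open>?T\<close> kills \<open>u\<close>, pairing with \<open>w\<close>
      leaves (w b)(c u) = 0, a product of two scalars. As w b is nonzero, \<open>c\<close> kills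
      \<open>u\<close>; then so does \<open>A\<close>, and the first block column of
      \<open>Q\<close> would be degenerate.\<close>
    have "det ?T \<noteq> 0"
    proof
      assume "det ?T = 0"
      then obtain u where u: "u \<in> carrier_vec n" "u \<noteq> 0\<^sub>v n" "?T *\<^sub>v u = 0\<^sub>v n"
        using det_0_iff_vec_prod_zero[OF T] by auto
      have cu: "c *\<^sub>v u \<in> carrier_vec 1" using blk u by auto
      have split: "?T *\<^sub>v u = A *\<^sub>v u + b *\<^sub>v (c *\<^sub>v u)"
        using blk u by (simp add: add_mult_distrib_mat_vec[of _ n n] assoc_mult_mat_vec[of _ n 1 _ n])
      have "0 = w \<bullet> (?T *\<^sub>v u)" using u w by simp
      also have "\<dots> = w \<bullet> (A *\<^sub>v u) + w \<bullet> (b *\<^sub>v (c *\<^sub>v u))"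
        unfolding split using blk u w cu by (subst scalar_prod_add_distrib[of _ n]) auto
      also have "w \<bullet> (A *\<^sub>v u) = (transpose_mat A *\<^sub>v w) \<bullet> u"
        using transpose_vec_mult_scalar[OF blk(1) u(1) w(1)] by simp
      also have "\<dots> = 0" using w u by simp
      also have "w \<bullet> (b *\<^sub>v (c *\<^sub>v u)) = (transpose_mat b *\<^sub>v w) \<bullet> (c *\<^sub>v u)"
        using transpose_vec_mult_scalar[OF blk(2) cu w(1)] by simp
      also have "\<dots> = (transpose_mat b *\<^sub>v w) $ 0 * (c *\<^sub>v u) $ 0"
        using blk(3) by (simp add: scalar_prod_def)
      finally have "(transpose_mat b *\<^sub>v w) $ 0 * (c *\<^sub>v u) $ 0 = 0" by simp
      moreover have "(transpose_mat b *\<^sub>v w) $ 0 \<noteq> 0"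
      proof
        assume "(transpose_mat b *\<^sub>v w) $ 0 = 0"
        then have "transpose_mat b *\<^sub>v w = 0\<^sub>v 1" using blk(2) by (intro eq_vecI) auto
        with wb show False by blast
      qed
      ultimately have "(c *\<^sub>v u) $ 0 = 0" by simp
      then have cu0: "c *\<^sub>v u = 0\<^sub>v 1" using blk(3) by (intro eq_vecI) auto
      have "b *\<^sub>v 0\<^sub>v 1 = 0\<^sub>v n" using blk(2) by (auto intro!: eq_vecI)
      moreover have "A *\<^sub>v u \<in> carrier_vec n" using blk(1) u(1) by simp
      ultimately have "A *\<^sub>v u = 0\<^sub>v n" using u(3)
        by (simp only: split cu0 right_zero_vec)
      with inj u(1,2) cu0 show False by simp
    qed
    then show ?thesis using TX by (rule similar_matI_intertwine[OF X M T])
  qed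
qed

section \<open>Fixed vectors\<close>

definition fixset :: "'a::comm_semiring_1 mat \<Rightarrow> 'a vec set" where
  "fixset A = {v \<in> carrier_vec (dim_row A). A *\<^sub>v v = v}"

text \<open>Over a field the fixed covectors form the annihilator of the image of
  \<open>A - 1\<close>, so the condition says that every fixed vector lies in that image.
  Equivalently, no Jordan block for the eigenvalue 1 has size 1.\<close>

definition fix_orthogonal :: "'a::comm_semiring_1 mat \<Rightarrow> bool" where
  "fix_orthogonal A \<longleftrightarrow> (\<forall>v\<in>fixset A. \<forall>w\<in>fixset (transpose_mat A). w \<bullet> v = 0)"

section \<open>Finiteness and counting over a finite field\<close>

lemma bij_betw_vec_of_list: "bij_betw vec_of_list {xs. length xs = n} (carrier_vec n)"
proof (rule bij_betwI[of _ _ _ list_of_vec])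
  show "vec_of_list \<in> {xs. length xs = n} \<rightarrow> carrier_vec n"
  proof (rule Pi_I)
    fix xs assume "xs \<in> {xs. length xs = n}"
    then have "dim_vec (vec_of_list xs) = n" unfolding mem_Collect_eq dim_vec_of_list .
    then show "vec_of_list xs \<in> carrier_vec n" by (rule carrier_vecI)
  qed
  show "list_of_vec \<in> carrier_vec n \<rightarrow> {xs. length xs = n}"
  proof (rule Pi_I)
    fix v assume "v \<in> carrier_vec n"
    then have "dim_vec v = n" by (rule carrier_vecD)
    then show "list_of_vec v \<in> {xs. length xs = n}" by simp
  qed
qed (rule vec_list list_vec)+

lemma card_carrier_vec: "card (carrier_vec n :: 'a::finite vec set) = CARD('a) ^ n"
proof -
  have "card {xs :: 'a list. length xs = n} = card (carrier_vec n :: 'a vec set)"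
    by (rule bij_betw_same_card[OF bij_betw_vec_of_list])
  moreover have "card {xs :: 'a list. length xs = n} = CARD('a) ^ n"
    using card_lists_length_eq[of "UNIV :: 'a set" n] by (simp only: subset_UNIV simp_thms finite)
  ultimately show ?thesis by simp
qed

lemma finite_carrier_vec [simp]: "finite (carrier_vec n :: 'a::finite vec set)"
proof (rule card_ge_0_finite)
  have "0 < CARD('a) ^ n" by (rule zero_less_power[OF zero_less_card_finite])
  then show "0 < card (carrier_vec n :: 'a vec set)" by (simp only: card_carrier_vec)
qed

lemma finite_carrier_mat [simp]: "finite (carrier_mat n m :: 'a::finite mat set)"
proof -
  have "finite ((\<lambda>xs. mat_of_rows m xs) ` {xs::'a vec list. set xs \<subseteq> carrier_vec m \<and> length xs = n})"
    by (intro finite_imageI finite_lists_length_eq finite_carrier_vec)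
  moreover have "A \<in> (\<lambda>xs. mat_of_rows m xs) ` {xs. set xs \<subseteq> carrier_vec m \<and> length xs = n}"
    if "A \<in> carrier_mat n m" for A :: "'a mat"
  proof (rule image_eqI)
    show "A = mat_of_rows m (rows A)" using mat_of_rows_rows[of A] that by simp
    show "rows A \<in> {xs. set xs \<subseteq> carrier_vec m \<and> length xs = n}"
      using that rows_carrier[of A] by simp
  qed
  ultimately show ?thesis by (rule finite_subset[OF subsetI, rotated])
qed

lemma finite_GL [simp]: "finite (GL n :: 'a::{finite, field} mat set)"
  by (rule finite_subset[OF _ finite_carrier_mat[of n n]]) (auto simp: GL_def)

lemma fixset_subset: "fixset A \<subseteq> carrier_vec (dim_row A)"
  by (auto simp: fixset_def)

lemma finite_fixset [simp]: "finite (fixset (A :: 'a::{finite, field} mat))"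
  by (rule finite_subset[OF fixset_subset]) simp

section \<open>Fixed vectors of direct sums and of similar matrices\<close>

lemma fixset_dsum:
  fixes A B :: "'a::comm_semiring_1 mat"
  assumes A: "A \<in> carrier_mat n n" and B: "B \<in> carrier_mat m m"
  shows "fixset (dsum A B) = (\<lambda>(u, v). u @\<^sub>v v) ` (fixset A \<times> fixset B)"
proof (intro equalityI subsetI)
  fix x assume x: "x \<in> fixset (dsum A B)"
  then have xc: "x \<in> carrier_vec (n + m)" using A B by (simp add: fixset_def)
  define u v where "u = vec_first x n" and "v = vec_last x m"
  have uv: "u \<in> carrier_vec n" "v \<in> carrier_vec m" and xuv: "x = u @\<^sub>v v"
    using xc by (simp_all add: u_def v_def)
  have "(A *\<^sub>v u) @\<^sub>v (B *\<^sub>v v) = u @\<^sub>v v"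
    using x dsum_mult_vec[OF A B uv] by (simp add: fixset_def xuv)
  moreover have "A *\<^sub>v u \<in> carrier_vec n" using A uv by simp
  ultimately have "A *\<^sub>v u = u" "B *\<^sub>v v = v"
    using append_vec_eq[of "A *\<^sub>v u" n u] uv by auto
  then show "x \<in> (\<lambda>(u, v). u @\<^sub>v v) ` (fixset A \<times> fixset B)"
    using uv A B xuv by (auto simp: fixset_def)
next
  fix x assume "x \<in> (\<lambda>(u, v). u @\<^sub>v v) ` (fixset A \<times> fixset B)"
  then show "x \<in> fixset (dsum A B)"
    using A B dsum_mult_vec[OF A B] by (auto simp: fixset_def)
qed

lemma card_fixset_dsum:
  fixes A B :: "'a::comm_semiring_1 mat"
  assumes A: "A \<in> carrier_mat n n" and B: "B \<in> carrier_mat m m"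
  shows "card (fixset (dsum A B)) = card (fixset A) * card (fixset B)"
proof -
  have "inj_on (\<lambda>(u, v). u @\<^sub>v v) (fixset A \<times> fixset B)"
    using A append_vec_eq by (auto simp: inj_on_def fixset_def)
  then show ?thesis
    unfolding fixset_dsum[OF A B] by (simp add: card_image card_cartesian_product)
qed

lemma fix_orthogonal_dsum:
  fixes A B :: "'a::comm_semiring_1 mat"
  assumes A: "A \<in> carrier_mat n n" and B: "B \<in> carrier_mat m m"
    and "fix_orthogonal A" "fix_orthogonal B"
  shows "fix_orthogonal (dsum A B)"
  using assms fixset_dsum[OF A B] fixset_dsum[of "transpose_mat A" n "transpose_mat B" m]
  unfolding fix_orthogonal_def transpose_dsum[OF A B]
  by (auto simp: scalar_prod_append[of _ n _ m] fixset_def)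

lemma fixset_similar:
  fixes A B :: "'a::comm_semiring_1 mat"
  assumes "A \<in> carrier_mat n n" "B \<in> carrier_mat n n" "P \<in> carrier_mat n n" "Q \<in> carrier_mat n n"
    and PQ: "P * Q = 1\<^sub>m n" "Q * P = 1\<^sub>m n" and A: "A = P * B * Q"
  shows "bij_betw (\<lambda>v. Q *\<^sub>v v) (fixset A) (fixset B)"
proof (rule bij_betwI[of _ _ _ "\<lambda>v. P *\<^sub>v v"])
  have c [simp]: "Q *\<^sub>v (P *\<^sub>v v) = v" "P *\<^sub>v (Q *\<^sub>v v) = v" if "v \<in> carrier_vec n" for v
    using that assms(3,4) PQ by (simp_all flip: assoc_mult_mat_vec[of _ n n _ n])
  have Av: "A *\<^sub>v v = P *\<^sub>v (B *\<^sub>v (Q *\<^sub>v v))" if "v \<in> carrier_vec n" for v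
    unfolding A using that assms(2,3,4) by (simp add: assoc_mult_mat_vec[of _ n n _ n])
  show "(\<lambda>v. Q *\<^sub>v v) \<in> fixset A \<rightarrow> fixset B"
  proof
    fix v assume "v \<in> fixset A"
    then have v: "v \<in> carrier_vec n" "P *\<^sub>v (B *\<^sub>v (Q *\<^sub>v v)) = v"
      using assms(1) Av by (auto simp: fixset_def)
    have "B *\<^sub>v (Q *\<^sub>v v) = Q *\<^sub>v (P *\<^sub>v (B *\<^sub>v (Q *\<^sub>v v)))"
      using assms(2,4) v(1) by simp
    then show "Q *\<^sub>v v \<in> fixset B" using v assms(2,4) by (simp add: fixset_def)
  qed
  show "(\<lambda>v. P *\<^sub>v v) \<in> fixset B \<rightarrow> fixset A"
    using assms(1,2,3) Av by (auto simp: fixset_def)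
  show "P *\<^sub>v (Q *\<^sub>v v) = v" if "v \<in> fixset A" for v
    using that assms(1) by (simp add: fixset_def)
  show "Q *\<^sub>v (P *\<^sub>v v) = v" if "v \<in> fixset B" for v
    using that assms(2) by (simp add: fixset_def)
qed

lemma card_fixset_similar:
  fixes A B :: "'a::comm_semiring_1 mat"
  assumes "similar_mat A B"
  shows "card (fixset A) = card (fixset B)"
proof -
  obtain n P Q where "A \<in> carrier_mat n n" "B \<in> carrier_mat n n" "P \<in> carrier_mat n n"
      "Q \<in> carrier_mat n n" "P * Q = 1\<^sub>m n" "Q * P = 1\<^sub>m n" "A = P * B * Q"
    using similar_matD[OF assms] by blast
  from bij_betw_same_card[OF fixset_similar[OF this]] show ?thesis .
qed

text \<open>\<open>Q\<close> transports fixed vectors and the transpose of \<open>P\<close>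
  transports fixed covectors; the pairing is preserved because \<open>P * Q\<close> is the
  identity.\<close>

lemma fix_orthogonal_similar:
  fixes A B :: "'a::comm_semiring_1 mat"
  assumes sim: "similar_mat A B" and orth: "fix_orthogonal B"
  shows "fix_orthogonal A"
  unfolding fix_orthogonal_def
proof (intro ballI)
  fix v w assume v: "v \<in> fixset A" and w: "w \<in> fixset (transpose_mat A)"
  obtain n P Q where *: "A \<in> carrier_mat n n" "B \<in> carrier_mat n n" "P \<in> carrier_mat n n"
      "Q \<in> carrier_mat n n" "P * Q = 1\<^sub>m n" "Q * P = 1\<^sub>m n" "A = P * B * Q"
    using similar_matD[OF sim] by blast
  have t: "transpose_mat (X * Y) = transpose_mat Y * transpose_mat X"
    if "X \<in> carrier_mat n n" "Y \<in> carrier_mat n n" for X Y :: "'a mat"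
    using that by (simp add: transpose_mult)
  have "transpose_mat Q * transpose_mat P = 1\<^sub>m n" "transpose_mat P * transpose_mat Q = 1\<^sub>m n"
    unfolding t[OF *(3,4), symmetric] t[OF *(4,3), symmetric] *(5,6) by simp_all
  moreover have "transpose_mat A = transpose_mat Q * transpose_mat B * transpose_mat P"
    unfolding *(7) using *(2-4) by (simp add: t assoc_mult_mat[of _ n n _ n _ n])
  ultimately have "bij_betw (\<lambda>v. transpose_mat P *\<^sub>v v) (fixset (transpose_mat A)) (fixset (transpose_mat B))"
    using *(1-4) by (intro fixset_similar[of _ n _ "transpose_mat Q"]) auto
  then have Pw: "transpose_mat P *\<^sub>v w \<in> fixset (transpose_mat B)"
    using w by (auto dest: bij_betwE)
  have Qv: "Q *\<^sub>v v \<in> fixset B"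
    using v fixset_similar[OF *] by (auto dest: bij_betwE)
  have vw: "v \<in> carrier_vec n" "w \<in> carrier_vec n"
    using v w *(1) by (auto simp: fixset_def)
  have "w \<bullet> v = w \<bullet> (P *\<^sub>v (Q *\<^sub>v v))"
    using vw *(3,4,5) by (simp flip: assoc_mult_mat_vec[of _ n n _ n])
  also have "\<dots> = (transpose_mat P *\<^sub>v w) \<bullet> (Q *\<^sub>v v)"
    using transpose_vec_mult_scalar[OF *(3) _ vw(2), of "Q *\<^sub>v v"] *(4) vw by simp
  also have "\<dots> = 0" using Pw Qv orth unfolding fix_orthogonal_def by blast
  finally show "w \<bullet> v = 0" .
qed

text \<open>This is dim U + dim W \<le> dim (U \<inter> W) + n in counting form: the subtraction map
  from U \<times> W to the whole space has fibres no larger than U \<inter> W.\<close>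

lemma card_fixset_mult_le:
  fixes x y :: "'a::{finite, field} mat"
  assumes x: "x \<in> carrier_mat n n" and y: "y \<in> carrier_mat n n"
  shows "card (fixset x) * card (fixset y) \<le> card (fixset x \<inter> fixset y) * CARD('a) ^ n"
proof -
  let ?S = "fixset x \<times> fixset y"
  let ?f = "\<lambda>(u, v). u - v :: 'a vec"
  have carr: "u \<in> carrier_vec n" if "u \<in> fixset x \<or> u \<in> fixset y" for u
    using that x y by (auto simp: fixset_def)
  have diff: "u - v \<in> fixset A" if "A \<in> carrier_mat n n" "u \<in> fixset A" "v \<in> fixset A" for u v and A :: "'a mat"
    using that mult_minus_distrib_mat_vec[of A n n u v] by (auto simp: fixset_def)
  have fib: "card {p \<in> ?S. ?f p = b} \<le> card (fixset x \<inter> fixset y)" if "b \<in> ?f ` ?S" for b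
  proof -
    from that obtain u0 v0 where 0: "u0 \<in> fixset x" "v0 \<in> fixset y" "b = u0 - v0" by auto
    \<comment> \<open>Relative to a base point of the fibre both components change by the same
      vector, which therefore lies in both fixed spaces and determines the point of the
      fibre.\<close>
    have shift: "u - u0 = v - v0" if "u \<in> fixset x" "v \<in> fixset y" "u - v = u0 - v0" for u v
    proof (rule eq_vecI)
      note c = carr[of u] carr[of v] carr[of u0] carr[of v0]
      fix i assume i: "i < dim_vec (v - v0)"
      have "i < n" using i c 0 by auto
      moreover have "(u - v) $ i = (u0 - v0) $ i" using that(3) by simp
      ultimately have "u $ i - v $ i = u0 $ i - v0 $ i" using c that 0
        by (metis carrier_vecD index_minus_vec(1))
      then have "u $ i - u0 $ i = v $ i - v0 $ i" by (simp add: algebra_simps)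
      then show "(u - u0) $ i = (v - v0) $ i" using c i that 0 by auto
    qed (use carr[of v0] carr[of u0] 0 in auto)
    show ?thesis
    proof (rule card_inj_on_le[of "\<lambda>(u, v). u - u0"])
      show "inj_on (\<lambda>(u, v). u - u0) {p \<in> ?S. ?f p = b}"
      proof (rule inj_onI)
        fix p p' assume "p \<in> {p \<in> ?S. ?f p = b}" "p' \<in> {p \<in> ?S. ?f p = b}"
          and "(case p of (u, v) \<Rightarrow> u - u0) = (case p' of (u, v) \<Rightarrow> u - u0)"
        then obtain u v u' v' where p: "p = (u, v)" "p' = (u', v')"
          and a: "u \<in> fixset x" "v \<in> fixset y" "u - v = b" "u' \<in> fixset x" "v' \<in> fixset y" "u' - v' = b"
          and eq: "u - u0 = u' - u0"
          by (cases p; cases p') simp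
        note c = carr[of u] carr[of v] carr[of u0] carr[of v0] carr[of u'] carr[of v']
        have cancel: "s = t" if "s - r = t - r" "s \<in> carrier_vec n" "t \<in> carrier_vec n" "r \<in> carrier_vec n"
          for s t r :: "'a vec"
        proof (rule eq_vecI)
          fix i assume "i < dim_vec t"
          moreover have "(s - r) $ i = (t - r) $ i" using that(1) by simp
          ultimately show "s $ i = t $ i" using that(2-4) by simp
        qed (use that in auto)
        have "v - v0 = v' - v0"
          using shift[of u v] shift[of u' v'] a eq 0(3) by simp
        then have "v = v'" using c a 0 by (intro cancel[of v v0 v']) auto
        moreover have "u = u'" using c a 0 eq by (intro cancel[of u u0 u']) auto
        ultimately show "p = p'" by (simp add: p)
      qed
      show "(\<lambda>(u, v). u - u0) ` {p \<in> ?S. ?f p = b} \<subseteq> fixset x \<inter> fixset y"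
      proof (rule image_subsetI)
        fix p assume "p \<in> {p \<in> ?S. ?f p = b}"
        then obtain u v where p: "p = (u, v)" and a: "u \<in> fixset x" "v \<in> fixset y" "u - v = b"
          by (cases p) simp
        have "u - u0 \<in> fixset x" using diff[OF x] a 0 by blast
        moreover have "v - v0 \<in> fixset y" using diff[OF y] a 0 by blast
        ultimately show "(case p of (u, v) \<Rightarrow> u - u0) \<in> fixset x \<inter> fixset y"
          using shift a 0 by (simp add: p)
      qed
    qed simp
  qed
  have "card (fixset x) * card (fixset y) = card ?S" by (simp add: card_cartesian_product)
  also have "\<dots> = (\<Sum>b\<in>?f ` ?S. card {p \<in> ?S. ?f p = b})"
    using sum.image_gen[of ?S "\<lambda>_. 1 :: nat" ?f] by simp
  also have "\<dots> \<le> (\<Sum>b\<in>?f ` ?S. card (fixset x \<inter> fixset y))"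
    by (rule sum_mono) (rule fib)
  also have "\<dots> = card (?f ` ?S) * card (fixset x \<inter> fixset y)" by simp
  also have "card (?f ` ?S) \<le> card (carrier_vec n :: 'a vec set)"
    by (rule card_mono) (use carr in auto)
  finally show ?thesis by (simp add: card_carrier_vec mult.commute)
qed

text \<open>The inclusion of \<open>fixset x \<inter> fixset y\<close> in
  \<open>fixset (x * y)\<close> holds for any two factors. The cardinality hypothesis says that the
  codimensions add up, and the counting inequality then leaves no room for the inclusion to be
  proper.\<close>

lemma fixset_mult_subset:
  fixes x y :: "'a::{finite, field} mat"
  assumes x: "x \<in> carrier_mat n n" and y: "y \<in> carrier_mat n n"
    and card: "card (fixset x) * card (fixset y) = card (fixset (x * y)) * CARD('a) ^ n"
  shows "fixset (x * y) \<subseteq> fixset x \<inter> fixset y"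
proof -
  have "fixset x \<inter> fixset y \<subseteq> fixset (x * y)"
    using x y assoc_mult_mat_vec[OF x y] by (auto simp: fixset_def)
  moreover have "card (fixset (x * y)) \<le> card (fixset x \<inter> fixset y)"
    using card_fixset_mult_le[OF x y] unfolding card by simp
  ultimately have "fixset x \<inter> fixset y = fixset (x * y)"
    by (intro card_seteq) auto
  then show ?thesis by simp
qed

section \<open>Companion matrices\<close>

lemma dim_companion_mat [simp]:
  "dim_row (companion_mat p) = degree p" "dim_col (companion_mat p) = degree p"
  by (simp_all add: companion_mat_def Let_def)

lemma companion_mat_carrier: "companion_mat p \<in> carrier_mat (degree p) (degree p)"
  by (rule carrier_matI) simp_all

text \<open>Multiplication by \<open>t\<close> shifts the coefficients up by one, and the
  overflowing power of \<open>t\<close> is reduced by means of the monic \<open>p\<close>.\<close>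

lemma companion_mult_vec:
  fixes p :: "'a::field poly"
  assumes v: "v \<in> carrier_vec (degree p)" and i: "i < degree p"
  shows "(companion_mat p *\<^sub>v v) $ i =
    (if i = 0 then 0 else v $ (i - 1)) - coeff p i * v $ (degree p - 1)"
proof -
  let ?d = "degree p"
  have "(companion_mat p *\<^sub>v v) $ i =
      (\<Sum>j<?d. (if j = ?d - 1 then - coeff p i else if i = j + 1 then 1 else 0) * v $ j)"
    using v i by (simp add: scalar_prod_def companion_mat_def Let_def atLeast0LessThan)
  also have "\<dots> = (\<Sum>j<?d. (if j = ?d - 1 then - coeff p i * v $ j else 0)
      + (if i = j + 1 then v $ j else 0))"
    using i by (intro sum.cong) auto
  also have "\<dots> = - coeff p i * v $ (?d - 1) + (\<Sum>j<?d. if i = j + 1 then v $ j else 0)"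
    using i by (simp add: sum.distrib)
  also have "(\<Sum>j<?d. if i = j + 1 then v $ j else 0) = (if i = 0 then 0 else v $ (i - 1))"
  proof (cases i)
    case (Suc k)
    then have "(\<Sum>j<?d. if i = j + 1 then v $ j else 0) = (\<Sum>j<?d. if k = j then v $ j else 0)"
      by (intro sum.cong) auto
    then show ?thesis using Suc i by simp
  qed simp
  finally show ?thesis by simp
qed

text \<open>The transpose is the shift of a linear recurrence: the window moves on by one place, and
  \<open>p\<close> determines the new last term.\<close>

lemma transpose_companion_mult_vec:
  fixes p :: "'a::field poly"
  assumes v: "v \<in> carrier_vec (degree p)" and j: "j < degree p"
  shows "(transpose_mat (companion_mat p) *\<^sub>v v) $ j =
    (if j = degree p - 1 then - (\<Sum>i<degree p. coeff p i * v $ i) else v $ (j + 1))"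
proof -
  let ?d = "degree p"
  have "(transpose_mat (companion_mat p) *\<^sub>v v) $ j =
      (\<Sum>i<?d. (if j = ?d - 1 then - coeff p i else if i = j + 1 then 1 else 0) * v $ i)"
    using v j by (simp add: scalar_prod_def companion_mat_def Let_def atLeast0LessThan)
  also have "\<dots> = (if j = ?d - 1 then (\<Sum>i<?d. - (coeff p i * v $ i)) else (\<Sum>i<?d. if i = j + 1 then v $ i else 0))"
  proof (cases "j = ?d - 1")
    case False
    then have "(\<Sum>i<?d. (if j = ?d - 1 then - coeff p i else if i = j + 1 then 1 else 0) * v $ i) =
        (\<Sum>i<?d. if i = j + 1 then v $ i else 0)"
      by (intro sum.cong) auto
    with False show ?thesis by simp
  qed simp
  also have "\<dots> = (if j = ?d - 1 then - (\<Sum>i<?d. coeff p i * v $ i) else v $ (j + 1))"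
    using j by (auto simp: sum_negf)
  finally show ?thesis .
qed

lemma poly_monic_lessThan:
  fixes p :: "'a::field poly"
  assumes "lead_coeff p = 1"
  shows "poly p a = (\<Sum>i<degree p. coeff p i * a ^ i) + a ^ degree p"
  by (simp only: poly_altdef lessThan_Suc_atMost[symmetric] sum.lessThan_Suc assms mult_1_left)

text \<open>Eigenvectors of a recurrence shift are geometric sequences, and the last coordinate
  imposes the root condition. The case \<open>a = 0\<close> gives invertibility of companion blocks,
  the case \<open>a = 1\<close> their fixed covectors.\<close>

lemma transpose_companion_eigenvector:
  fixes p :: "'a::field poly"
  assumes p: "lead_coeff p = 1" "degree p > 0" and v: "v \<in> carrier_vec (degree p)"
    and eig: "transpose_mat (companion_mat p) *\<^sub>v v = a \<cdot>\<^sub>v v"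
  shows "poly p a * v $ 0 = 0" "\<And>j. j < degree p \<Longrightarrow> v $ j = a ^ j * v $ 0"
proof -
  let ?d = "degree p"
  have e: "(if j = ?d - 1 then - (\<Sum>i<?d. coeff p i * v $ i) else v $ (j + 1)) = a * v $ j" if "j < ?d" for j
    using transpose_companion_mult_vec[OF v that] that v unfolding eig by simp
  show pow: "v $ j = a ^ j * v $ 0" if "j < ?d" for j
    using that
  proof (induction j)
    case (Suc j)
    then have "j \<noteq> ?d - 1" by simp
    then show ?case using Suc e[of j] by (simp add: mult.assoc)
  qed simp
  have "a ^ ?d * v $ 0 = a * v $ (?d - 1)"
    using p(2) pow[of "?d - 1"] by (cases ?d) auto
  also have "\<dots> = - (\<Sum>i<?d. coeff p i * v $ i)" using e[of "?d - 1"] p(2) by simp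
  also have "(\<Sum>i<?d. coeff p i * v $ i) = (\<Sum>i<?d. coeff p i * a ^ i) * v $ 0"
    unfolding sum_distrib_right
  proof (rule sum.cong)
    fix i assume "i \<in> {..<?d}"
    then show "coeff p i * v $ i = coeff p i * a ^ i * v $ 0" using pow[of i] by simp
  qed simp
  finally show "poly p a * v $ 0 = 0"
    unfolding poly_monic_lessThan[OF p(1)] by (simp add: distrib_right)
qed

text \<open>A kernel vector of the transpose is an eigenvector for 0: its entry at index 0 vanishes
  because \<open>poly p 0\<close> does not, and all other entries are multiples of that one.\<close>

lemma det_companion_mat_nonzero:
  fixes p :: "'a::field poly"
  assumes p: "lead_coeff p = 1" "degree p > 0" and p0: "poly p 0 \<noteq> 0"
  shows "det (companion_mat p) \<noteq> 0"
proof
  assume "det (companion_mat p) = 0"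
  then have "det (transpose_mat (companion_mat p)) = 0"
    using det_transpose[OF companion_mat_carrier, of p] by simp
  then obtain v where v: "v \<in> carrier_vec (degree p)" "v \<noteq> 0\<^sub>v (degree p)"
      and eq: "transpose_mat (companion_mat p) *\<^sub>v v = 0\<^sub>v (degree p)"
    using det_0_iff_vec_prod_zero[of "transpose_mat (companion_mat p)" "degree p"] companion_mat_carrier[of p]
    by auto
  have "0\<^sub>v (degree p) = 0 \<cdot>\<^sub>v v" using v(1) by auto
  note eig = transpose_companion_eigenvector[OF p v(1) eq[unfolded this]]
  have "v $ 0 = 0" using eig(1) p0 by simp
  then have "v = 0\<^sub>v (degree p)" using eig(2) v(1) by (intro eq_vecI) simp_all
  with v(2) show False ..
qed

lemma fixset_transpose_companion:
  fixes p :: "'a::field poly"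
  assumes p: "lead_coeff p = 1" "degree p > 0"
  shows "fixset (transpose_mat (companion_mat p)) =
    (\<lambda>s. vec (degree p) (\<lambda>_. s)) ` (if poly p 1 = 0 then UNIV else {0})"
proof (intro equalityI subsetI)
  fix v assume "v \<in> fixset (transpose_mat (companion_mat p))"
  then have v: "v \<in> carrier_vec (degree p)" and Tv: "transpose_mat (companion_mat p) *\<^sub>v v = v"
    by (simp_all add: fixset_def)
  have "v = 1 \<cdot>\<^sub>v v" by (intro eq_vecI) simp_all
  note eig = transpose_companion_eigenvector[OF p v Tv[THEN trans, OF this]]
  have "v = vec (degree p) (\<lambda>_. v $ 0)"
  proof (rule eq_vecI)
    fix j assume j: "j < dim_vec (vec (degree p) (\<lambda>_. v $ 0))"
    show "v $ j = vec (degree p) (\<lambda>_. v $ 0) $ j" using eig(2)[of j] j by simp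
  qed (use v in simp)
  moreover have "v $ 0 \<in> (if poly p 1 = 0 then UNIV else {0})" using eig(1) by auto
  ultimately show "v \<in> (\<lambda>s. vec (degree p) (\<lambda>_. s)) ` (if poly p 1 = 0 then UNIV else {0})"
    by (rule image_eqI)
next
  fix v :: "'a vec" assume "v \<in> (\<lambda>s. vec (degree p) (\<lambda>_. s)) ` (if poly p 1 = 0 then UNIV else {0})"
  then obtain s where v: "v = vec (degree p) (\<lambda>_. s)" and s: "poly p 1 * s = 0"
    by (auto split: if_splits)
  have "- (\<Sum>i<degree p. coeff p i * v $ i) = s"
    using s unfolding poly_monic_lessThan[OF p(1)] v
    by (simp add: sum_distrib_right[symmetric] distrib_right add_eq_0_iff)
  then have "transpose_mat (companion_mat p) *\<^sub>v v = v"
    using transpose_companion_mult_vec[of v p] by (intro eq_vecI) (auto simp: v)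
  then show "v \<in> fixset (transpose_mat (companion_mat p))"
    by (simp add: fixset_def v)
qed

text \<open>A fixed vector is an element of F[t]/(p) annihilated by t - 1. Nonzero ones exist only
  if p(1) = 0, and they are then the multiples of p/(t - 1), whose coefficients are the negated
  partial sums of those of \<open>p\<close>. The parameter \<open>s\<close> is the last
  coordinate.\<close>

lemma fixset_companion:
  fixes p :: "'a::field poly"
  assumes p: "lead_coeff p = 1" "degree p > 0"
  shows "fixset (companion_mat p) =
    (\<lambda>s. vec (degree p) (\<lambda>i. - s * (\<Sum>j\<le>i. coeff p j))) ` (if poly p 1 = 0 then UNIV else {0})"
proof (intro equalityI subsetI)
  let ?d = "degree p"
  fix v assume "v \<in> fixset (companion_mat p)"
  then have v: "v \<in> carrier_vec ?d" "companion_mat p *\<^sub>v v = v" by (auto simp: fixset_def)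
  define s where "s = v $ (?d - 1)"
  have e: "v $ i = (if i = 0 then 0 else v $ (i - 1)) - coeff p i * s" if "i < ?d" for i
    using companion_mult_vec[OF v(1) that] unfolding v(2) s_def .
  have sol: "v $ i = - s * (\<Sum>j\<le>i. coeff p j)" if "i < ?d" for i
    using that
  proof (induction i)
    case 0
    then show ?case using e[of 0] by simp
  next
    case (Suc i)
    then have "v $ Suc i = v $ i - coeff p (Suc i) * s" using e[of "Suc i"] by simp
    also have "v $ i = - s * (\<Sum>j\<le>i. coeff p j)" using Suc by simp
    finally show ?case by (simp add: algebra_simps eq_neg_iff_add_eq_0)
  qed
  have "{..?d - 1} = {..<?d}" using p(2) by auto
  then have "s = - (s * (\<Sum>j<?d. coeff p j))" using sol[of "?d - 1"] p(2) s_def by simp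
  then have "s * (\<Sum>j<?d. coeff p j) + s = 0" by (rule add_eq_0_iff[THEN iffD2])
  then have "poly p 1 * s = 0"
    unfolding poly_monic_lessThan[OF p(1)] by (simp add: algebra_simps)
  then have "s \<in> (if poly p 1 = 0 then UNIV else {0})" by auto
  moreover have "v = vec ?d (\<lambda>i. - s * (\<Sum>j\<le>i. coeff p j))"
    using sol v(1) by (intro eq_vecI) auto
  ultimately show "v \<in> (\<lambda>s. vec ?d (\<lambda>i. - s * (\<Sum>j\<le>i. coeff p j))) ` (if poly p 1 = 0 then UNIV else {0})"
    by (rule image_eqI[rotated])
next
  let ?d = "degree p"
  fix v assume "v \<in> (\<lambda>s. vec ?d (\<lambda>i. - s * (\<Sum>j\<le>i. coeff p j))) ` (if poly p 1 = 0 then UNIV else {0})"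
  then obtain s where v: "v = vec ?d (\<lambda>i. - s * (\<Sum>j\<le>i. coeff p j))" and s: "poly p 1 * s = 0"
    by (auto split: if_splits)
  have "{..?d - 1} = {..<?d}" using p(2) by auto
  moreover have "s * (\<Sum>j<?d. coeff p j) + s = 0"
    using s unfolding poly_monic_lessThan[OF p(1)] by (simp add: algebra_simps)
  ultimately have last: "v $ (?d - 1) = s"
    using p(2) by (simp add: v add_eq_0_iff)
  have "(companion_mat p *\<^sub>v v) $ i = v $ i" if "i < ?d" for i
  proof -
    have "v \<in> carrier_vec ?d" by (simp add: v)
    from companion_mult_vec[OF this \<open>i < ?d\<close>]
    have "(companion_mat p *\<^sub>v v) $ i = (if i = 0 then 0 else v $ (i - 1)) - coeff p i * s"
      unfolding last .
    also have "\<dots> = v $ i"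
      using that by (cases i) (simp_all add: v algebra_simps)
    finally show ?thesis .
  qed
  then have "companion_mat p *\<^sub>v v = v" by (intro eq_vecI) (auto simp: v)
  then show "v \<in> fixset (companion_mat p)" by (simp add: fixset_def v)
qed

lemma card_fixset_companion:
  fixes p :: "'a::{finite, field} poly"
  assumes p: "lead_coeff p = 1" "degree p > 0"
  shows "card (fixset (companion_mat p)) = CARD('a) ^ (if poly p 1 = 0 then 1 else 0)"
proof (cases "poly p 1 = 0")
  case True
  \<comment> \<open>The coefficients below the leading one sum to -1, so the last entry of the
    vector recovers the parameter.\<close>
  have "inj (\<lambda>s. vec (degree p) (\<lambda>i. - s * (\<Sum>j\<le>i. coeff p j)))"
  proof (rule injI)
    fix s t assume eq: "vec (degree p) (\<lambda>i. - s * (\<Sum>j\<le>i. coeff p j)) = vec (degree p) (\<lambda>i. - t * (\<Sum>j\<le>i. coeff p j))"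
    have "{..degree p - 1} = {..<degree p}" using p(2) by auto
    moreover have "(\<Sum>j<degree p. coeff p j) = - 1"
      using True unfolding poly_monic_lessThan[OF p(1)] by (simp add: eq_neg_iff_add_eq_0)
    ultimately show "s = t"
      using p(2) arg_cong[OF eq, of "\<lambda>v. v $ (degree p - 1)"] by simp
  qed
  then show ?thesis using True by (simp add: fixset_companion[OF p] card_image)
qed (simp add: fixset_companion[OF p])

lemma card_fixset_transpose_companion:
  fixes p :: "'a::{finite, field} poly"
  assumes p: "lead_coeff p = 1" "degree p > 0"
  shows "card (fixset (transpose_mat (companion_mat p))) = CARD('a) ^ (if poly p 1 = 0 then 1 else 0)"
proof (cases "poly p 1 = 0")
  case True
  have "inj (\<lambda>s::'a. vec (degree p) (\<lambda>_. s))"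
  proof (rule injI)
    fix s t :: 'a assume eq: "vec (degree p) (\<lambda>_. s) = vec (degree p) (\<lambda>_. t)"
    show "s = t" using p(2) arg_cong[OF eq, of "\<lambda>v. v $ 0"] by simp
  qed
  then show ?thesis using True by (simp add: fixset_transpose_companion[OF p] card_image)
qed (simp add: fixset_transpose_companion[OF p])

text \<open>For \<open>j < d\<close>, the term \<open>c j\<close> occurs in exactly
  \<open>d - j\<close> of the partial sums.\<close>

lemma sum_partial_sums:
  fixes c :: "nat \<Rightarrow> 'a::comm_ring_1"
  shows "(\<Sum>i<d. \<Sum>j\<le>i. c j) = of_nat d * (\<Sum>j<d. c j) - (\<Sum>j<d. of_nat j * c j)"
proof (induction d)
  case (Suc d)
  have "(\<Sum>j\<le>d. c j) = (\<Sum>j<d. c j) + c d"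
    by (simp only: lessThan_Suc_atMost[symmetric] sum.lessThan_Suc)
  with Suc.IH show ?case by (simp add: algebra_simps)
qed simp

text \<open>A fixed covector of a companion block is constant, and the sum of the entries of a fixed
  vector is a multiple of \<open>p'(1)\<close>.\<close>
lemma fix_orthogonal_companion:
  fixes p :: "'a::field poly"
  assumes p: "lead_coeff p = 1" "degree p > 0" and root: "poly p 1 = 0 \<Longrightarrow> poly (pderiv p) 1 = 0"
  shows "fix_orthogonal (companion_mat p)"
  unfolding fix_orthogonal_def
proof (intro ballI)
  let ?d = "degree p"
  fix v w assume v: "v \<in> fixset (companion_mat p)" and w: "w \<in> fixset (transpose_mat (companion_mat p))"
  obtain s where s: "v = vec ?d (\<lambda>i. - s * (\<Sum>j\<le>i. coeff p j))" "poly p 1 = 0 \<or> s = 0"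
    using v unfolding fixset_companion[OF p] by (auto split: if_splits)
  obtain r where r: "w = vec ?d (\<lambda>_. r)"
    using w unfolding fixset_transpose_companion[OF p] by auto
  \<comment> \<open>The covector is constant, so only the sum of the entries of \<open>v\<close>
    matters; for p(1) = 0 it is \<open>s\<close> times the value of p/(t - 1) at 1, that is
    \<open>s\<close> times p'(1).\<close>
  have "w \<bullet> v = - r * s * (\<Sum>i<?d. \<Sum>j\<le>i. coeff p j)"
    unfolding r s(1) by (simp add: scalar_prod_def atLeast0LessThan sum_distrib_left sum_negf mult.assoc)
  also have "\<dots> = 0"
  proof (cases "s = 0")
    case False
    then have p1: "poly p 1 = 0" using s(2) by simp
    have "(\<Sum>j<?d. coeff p j) = - 1"
      using p1 unfolding poly_monic_lessThan[OF p(1)] by (simp add: eq_neg_iff_add_eq_0)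
    moreover have "(\<Sum>j<?d. of_nat j * coeff p j) = - of_nat ?d"
    proof -
      have "poly (pderiv p) 1 = (\<Sum>i\<le>degree (pderiv p). of_nat (Suc i) * coeff p (Suc i))"
        by (simp add: poly_altdef coeff_pderiv)
      \<comment> \<open>In positive characteristic the derivative may have degree below
        \<open>?d - 1\<close>; the added terms vanish.\<close>
      also have "\<dots> = (\<Sum>i<?d. of_nat (Suc i) * coeff p (Suc i))"
      proof (rule sum.mono_neutral_left)
        show "\<forall>i\<in>{..<?d} - {..degree (pderiv p)}. of_nat (Suc i) * coeff p (Suc i) = 0"
        proof
          fix i assume "i \<in> {..<?d} - {..degree (pderiv p)}"
          then have "coeff (pderiv p) i = 0" by (simp add: coeff_eq_0)
          then show "of_nat (Suc i) * coeff p (Suc i) = 0" by (simp add: coeff_pderiv)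
        qed
        show "{..degree (pderiv p)} \<subseteq> {..<?d}"
        proof -
          have "degree (pderiv p) \<le> ?d - 1"
            by (rule degree_le) (use p(2) in \<open>auto simp: coeff_pderiv coeff_eq_0\<close>)
          then show ?thesis using p(2) by auto
        qed
      qed simp
      also have "\<dots> = (\<Sum>i<Suc ?d. of_nat i * coeff p i)"
        by (simp only: sum.lessThan_Suc_shift) simp
      also have "\<dots> = (\<Sum>i<?d. of_nat i * coeff p i) + of_nat ?d" using p(1) by simp
      finally show ?thesis using root[OF p1] by (simp add: add_eq_0_iff2)
    qed
    ultimately show ?thesis unfolding sum_partial_sums by simp
  qed simp
  finally show "w \<bullet> v = 0" .
qed

section \<open>Block matrices of a type\<close>

definition block_mset :: "('a::field poly \<Rightarrow> nat list) \<Rightarrow> ('a poly \<times> nat) multiset" where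
  "block_mset lam = (\<Sum>f\<in>{f. lam f \<noteq> []}. mset (map (\<lambda>k. (f, k)) (lam f)))"

definition block_mat :: "('a::field poly \<times> nat) list \<Rightarrow> 'a mat" where
  "block_mat bs = diag_block_mat (map (\<lambda>(f, k). companion_mat (f ^ k)) bs)"

text \<open>A condition on each block separately, hence inherited by the tail in inductions over
  block lists.\<close>

definition valid_blocks :: "('a::field poly \<times> nat) list \<Rightarrow> bool" where
  "valid_blocks bs \<longleftrightarrow> (\<forall>(f, k)\<in>set bs. f \<in> Phi \<and> 0 < k)"

lemma has_type_iff:
  "has_type g lam \<longleftrightarrow>
    lam \<in> PPhi \<and> (\<exists>bs. mset bs = block_mset lam \<and> similar_mat g (block_mat bs))"
  by (simp add: has_type_def block_mset_def block_mat_def)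

lemma PPhiD:
  assumes "lam \<in> PPhi"
  shows "is_partition (lam f)" "lam f \<noteq> [] \<Longrightarrow> f \<in> Phi" "finite {f. lam f \<noteq> []}"
  using assms by (auto simp: PPhi_def)

lemma count_block_mset:
  assumes "finite {f. lam f \<noteq> []}"
  shows "count (block_mset lam) (f, k) = count (mset (lam f)) k"
proof -
  have *: "count (mset (map (\<lambda>k. (g, k)) xs)) (f, k) = (if f = g then count (mset xs) k else 0)" for g xs
    by (induction xs) auto
  have "count (block_mset lam) (f, k) = (\<Sum>g\<in>{f. lam f \<noteq> []}. if f = g then count (mset (lam g)) k else 0)"
    unfolding block_mset_def count_sum * ..
  also have "\<dots> = count (mset (lam f)) k"
    using assms by simp
  finally show ?thesis .
qed

text \<open>Two weights matter later: the size of a block, whose total is \<open>pnorm\<close>, and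
  the indicator of t - 1, whose total is the dimension of the fixed space.\<close>

lemma sum_list_blocks:
  fixes h :: "'a::field poly \<times> nat \<Rightarrow> nat"
  assumes "finite {f. lam f \<noteq> []}" "mset bs = block_mset lam"
  shows "(\<Sum>b\<leftarrow>bs. h b) = (\<Sum>f\<in>{f. lam f \<noteq> []}. \<Sum>k\<leftarrow>lam f. h (f, k))"
proof -
  have *: "(\<Sum>x\<in>#(\<Sum>f\<in>S. mset (map (\<lambda>k. (f, k)) (lam f))). h x) = (\<Sum>f\<in>S. \<Sum>k\<leftarrow>lam f. h (f, k))"
    if "finite S" for S
    using that
  proof (induction S)
    case (insert f S)
    have "(\<Sum>x\<in>#mset (map (\<lambda>k. (f, k)) (lam f)). h x) = (\<Sum>k\<leftarrow>lam f. h (f, k))"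
      by (simp flip: mset_map add: sum_mset_sum_list o_def)
    with insert show ?case by (simp del: mset_map)
  qed simp
  have "(\<Sum>b\<leftarrow>bs. h b) = (\<Sum>x\<in>#mset bs. h x)"
    by (simp flip: mset_map add: sum_mset_sum_list)
  then show ?thesis using *[OF assms(1)] by (simp only: assms(2) block_mset_def)
qed

lemma set_blocks:
  assumes "lam \<in> PPhi" "mset bs = block_mset lam"
  shows "(f, k) \<in> set bs \<longleftrightarrow> k \<in> set (lam f)"
proof -
  have "(f, k) \<in> set bs \<longleftrightarrow> 0 < count (mset bs) (f, k)" by simp
  also have "\<dots> \<longleftrightarrow> k \<in> set (lam f)"
    unfolding assms(2) count_block_mset[OF PPhiD(3)[OF assms(1)]] by simp
  finally show ?thesis .
qed

lemma valid_blocksI: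
  assumes lam: "lam \<in> PPhi" and bs: "mset bs = block_mset lam"
  shows "valid_blocks bs"
proof -
  have "f \<in> Phi \<and> 0 < k" if "(f, k) \<in> set bs" for f k
  proof -
    from that have k: "k \<in> set (lam f)" using set_blocks[OF assms] by simp
    then have "lam f \<noteq> []" by auto
    then show ?thesis using k PPhiD(1,2)[OF lam, of f] by (auto simp: is_partition_def)
  qed
  then show ?thesis by (auto simp: valid_blocks_def)
qed

section \<open>Monic irreducible polynomials and their powers\<close>

lemma Phi_degree: "f \<in> Phi \<Longrightarrow> 0 < degree f" for f :: "'a::field poly"
  by (auto simp: Phi_def irreducible_def is_unit_iff_degree intro: Nat.gr0I)

lemma Phi_root:
  fixes f :: "'a::field poly"
  assumes f: "f \<in> Phi" and root: "poly f a = 0"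
  shows "f = [:-a, 1:]"
proof -
  from root obtain q where q: "f = [:-a, 1:] * q" by (auto simp: poly_eq_0_iff_dvd dvd_def)
  have irr: "irreducible f" and lc: "lead_coeff f = 1" using f by (auto simp: Phi_def)
  have "q dvd 1"
    using irreducibleD[OF irr q] by (auto simp: is_unit_iff_degree)
  then obtain c where c: "q = [:c:]" by (metis is_unit_polyE)
  have "lead_coeff f = c" unfolding q lead_coeff_mult c by simp
  then have "c = 1" using lc by simp
  then show ?thesis using q c by simp
qed

text \<open>An element of \<open>Phi\<close> with a root is linear. Excluding \<open>t\<close>
  therefore rules out the root 0, which makes the blocks invertible, and t - 1 is the only element
  that vanishes at 1.\<close>

lemma Phi_power:
  fixes f :: "'a::field poly"
  assumes f: "f \<in> Phi" and k: "0 < k"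
  shows "lead_coeff (f ^ k) = 1" "degree (f ^ k) = degree f * k" "0 < degree (f ^ k)"
    "poly (f ^ k) 0 \<noteq> 0" "poly (f ^ k) 1 = 0 \<longleftrightarrow> f = [:-1, 1:]"
proof -
  have lc: "lead_coeff f = 1" and 0: "f \<noteq> 0" using f by (auto simp: Phi_def)
  show "lead_coeff (f ^ k) = 1" using lc by (simp add: lead_coeff_power)
  show deg: "degree (f ^ k) = degree f * k" using degree_power_eq[OF 0] by (simp add: mult.commute)
  show "0 < degree (f ^ k)" unfolding deg using Phi_degree[OF f] k by simp
  show "poly (f ^ k) 0 \<noteq> 0" using Phi_root[OF f, of 0] f by (auto simp: Phi_def)
  show "poly (f ^ k) 1 = 0 \<longleftrightarrow> f = [:-1, 1:]" using Phi_root[OF f, of 1] k by auto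
qed

lemma e_in_Phi: "[:-1, 1:] \<in> (Phi :: 'a::field poly set)"
  by (simp add: Phi_def irreducible_linear_field_poly)

lemma companion_mat_linear: "companion_mat [:-1, 1:] = (1\<^sub>m 1 :: 'a::field mat)"
  by (rule eq_matI) (auto simp: companion_mat_def Let_def)

lemma block_mat_Nil: "block_mat [] = 0\<^sub>m 0 0"
  by (simp add: block_mat_def)

lemma block_mat_Cons: "block_mat ((f, k) # bs) = dsum (companion_mat (f ^ k)) (block_mat bs)"
  by (simp only: block_mat_def list.map prod.case diag_block_mat_Cons_dsum)

lemma block_mat_snoc: "block_mat (bs @ [([:-1, 1:], 1)]) = dsum (block_mat bs) (1\<^sub>m 1)"
  by (simp only: block_mat_def map_append list.map prod.case diag_block_mat_append_dsum
      diag_block_mat_singleton power_one_right companion_mat_linear)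

lemma block_mat_carrier:
  assumes "valid_blocks bs"
  shows "block_mat bs \<in> carrier_mat (\<Sum>(f, k)\<leftarrow>bs. degree f * k) (\<Sum>(f, k)\<leftarrow>bs. degree f * k)"
  using assms
proof (induction bs)
  case Nil
  show ?case unfolding block_mat_Nil by simp
next
  case (Cons b bs)
  obtain f k where b: "b = (f, k)" by fastforce
  from Cons.prems have v: "valid_blocks bs" "f \<in> Phi" "0 < k" by (auto simp: valid_blocks_def b)
  show ?case
    using dsum_carrier[OF companion_mat_carrier Cons.IH[OF v(1)], of "f ^ k"]
    unfolding b block_mat_Cons Phi_power(2)[OF v(2,3)] by simp
qed

lemma det_block_mat: "valid_blocks bs \<Longrightarrow> det (block_mat bs) \<noteq> 0"
proof (induction bs)
  case Nil
  show ?case unfolding block_mat_Nil by (simp add: det_dim_zero)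
next
  case (Cons b bs)
  obtain f k where b: "b = (f, k)" by fastforce
  from Cons.prems have v: "valid_blocks bs" "f \<in> Phi" "0 < k" by (auto simp: valid_blocks_def b)
  show ?case
    using Cons.IH[OF v(1)] det_companion_mat_nonzero[OF Phi_power(1,3,4)[OF v(2,3)]]
    unfolding b block_mat_Cons det_dsum[OF companion_mat_carrier block_mat_carrier[OF v(1)]] by simp
qed

lemma fix_zero_mat: "fixset (0\<^sub>m 0 0 :: 'a::field mat) = {0\<^sub>v 0}"
  by (auto simp: fixset_def)

text \<open>Each block belonging to t - 1 contributes a line of fixed vectors and a line of fixed
  covectors, whatever its size; the other blocks contribute only zero.\<close>

lemma card_fixset_block_mat:
  fixes bs :: "('a::{finite, field} poly \<times> nat) list"
  assumes "valid_blocks bs"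
  shows "card (fixset (block_mat bs)) = CARD('a) ^ (\<Sum>(f, k)\<leftarrow>bs. if f = [:-1, 1:] then 1 else 0)"
    "card (fixset (transpose_mat (block_mat bs))) = CARD('a) ^ (\<Sum>(f, k)\<leftarrow>bs. if f = [:-1, 1:] then 1 else 0)"
proof -
  have "card (fixset (block_mat bs)) = CARD('a) ^ (\<Sum>(f, k)\<leftarrow>bs. if f = [:-1, 1:] then 1 else 0)
     \<and> card (fixset (transpose_mat (block_mat bs))) = CARD('a) ^ (\<Sum>(f, k)\<leftarrow>bs. if f = [:-1, 1:] then 1 else 0)"
    using assms
  proof (induction bs)
    case Nil
    show ?case unfolding block_mat_Nil zero_transpose_mat fix_zero_mat by simp
  next
    case (Cons b bs)
    obtain f k where b: "b = (f, k)" by fastforce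
    from Cons.prems have v: "valid_blocks bs" "f \<in> Phi" "0 < k" by (auto simp: valid_blocks_def b)
    note C = companion_mat_carrier[of "f ^ k"] and B = block_mat_carrier[OF v(1)]
    note P = Phi_power[OF v(2,3)]
    have "card (fixset (block_mat (b # bs))) =
        CARD('a) ^ (if f = [:-1, 1:] then 1 else 0) * card (fixset (block_mat bs))"
      unfolding b block_mat_Cons card_fixset_dsum[OF C B] card_fixset_companion[OF P(1,3)] P(5) ..
    moreover have "card (fixset (transpose_mat (block_mat (b # bs)))) =
        CARD('a) ^ (if f = [:-1, 1:] then 1 else 0) * card (fixset (transpose_mat (block_mat bs)))"
      unfolding b block_mat_Cons transpose_dsum[OF C B]
        card_fixset_dsum[OF transpose_carrier_mat[THEN iffD2, OF C] transpose_carrier_mat[THEN iffD2, OF B]]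
        card_fixset_transpose_companion[OF P(1,3)] P(5) ..
    ultimately show ?case using Cons.IH[OF v(1)] by (simp add: b power_add)
  qed
  then show "card (fixset (block_mat bs)) = CARD('a) ^ (\<Sum>(f, k)\<leftarrow>bs. if f = [:-1, 1:] then 1 else 0)"
    "card (fixset (transpose_mat (block_mat bs))) = CARD('a) ^ (\<Sum>(f, k)\<leftarrow>bs. if f = [:-1, 1:] then 1 else 0)"
    by blast+
qed

text \<open>The blocks vanishing at 1 are those of (t - 1)^k with k \<ge> 2. There 1 is a multiple
  root, so the derivative vanishes at 1 in every characteristic.\<close>

lemma fix_orthogonal_block_mat:
  fixes bs :: "('a::field poly \<times> nat) list"
  assumes "valid_blocks bs" "([:-1, 1:], 1) \<notin> set bs"
  shows "fix_orthogonal (block_mat bs)"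
  using assms
proof (induction bs)
  case Nil
  show ?case unfolding block_mat_Nil fix_orthogonal_def zero_transpose_mat fix_zero_mat by simp
next
  case (Cons b bs)
  obtain f k where b: "b = (f, k)" by fastforce
  from Cons.prems have v: "valid_blocks bs" "f \<in> Phi" "0 < k" by (auto simp: valid_blocks_def b)
  note P = Phi_power[OF v(2,3)]
  have "poly (pderiv (f ^ k)) 1 = 0" if "poly (f ^ k) 1 = 0"
  proof -
    have f: "f = [:-1, 1:]" using that P(5) by simp
    then have root: "poly f 1 = 0" by simp
    from Cons.prems(2) b f have "k \<noteq> 1" by auto
    then obtain m where "k = Suc (Suc m)" using v(3) by (metis One_nat_def gr0_conv_Suc not0_implies_Suc)
    then show ?thesis by (simp add: pderiv_mult root)
  qed
  then have "fix_orthogonal (companion_mat (f ^ k))"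
    by (rule fix_orthogonal_companion[OF P(1,3)])
  then show ?case
    unfolding b block_mat_Cons
    by (rule fix_orthogonal_dsum[OF companion_mat_carrier block_mat_carrier[OF v(1)]])
      (use Cons.IH[OF v(1)] Cons.prems(2) in simp)
qed

lemma similar_block_mat_perm:
  assumes "mset bs = mset cs"
  shows "similar_mat (block_mat bs) (block_mat cs)"
  unfolding block_mat_def
  by (rule similar_diag_block_mat_perm) (use assms in \<open>auto simp: square_mat.simps\<close>)

section \<open>Modified types\<close>

lemma similar_mat_carrier:
  assumes "similar_mat A B" "B \<in> carrier_mat n n"
  shows "A \<in> carrier_mat n n"
proof -
  obtain m P Q where "{A, B, P, Q} \<subseteq> carrier_mat m m" using similar_matD[OF assms(1)] by blast
  then have "A \<in> carrier_mat m m" "B \<in> carrier_mat m m" by simp_all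
  with assms(2) show ?thesis by (metis carrier_matD(1))
qed

lemma sum_blocks_degree:
  assumes "lam \<in> PPhi" "mset bs = block_mset lam"
  shows "(\<Sum>(f, k)\<leftarrow>bs. degree f * k) = pnorm lam"
  using sum_list_blocks[OF PPhiD(3)[OF assms(1)] assms(2), of "\<lambda>(f, k). degree f * k"]
  by (simp add: pnorm_def sum_list_const_mult)

lemma sum_blocks_e:
  assumes "lam \<in> PPhi" "mset bs = block_mset lam"
  shows "(\<Sum>(f, k)\<leftarrow>bs. if f = [:-1, 1:] then 1 else 0) = length (epart lam)"
proof -
  have "(\<Sum>(f, k)\<leftarrow>bs. if f = [:-1, 1:] then 1 else 0 :: nat) =
      (\<Sum>f\<in>{f. lam f \<noteq> []}. \<Sum>k\<leftarrow>lam f. if f = [:-1, 1:] then 1 else 0)"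
    using sum_list_blocks[OF PPhiD(3)[OF assms(1)] assms(2), of "\<lambda>(f, k). if f = [:-1, 1:] then 1 else 0"]
    by simp
  also have "\<dots> = (\<Sum>f\<in>{f. lam f \<noteq> []}. if f = [:-1, 1:] then length (lam f) else 0)"
    by (intro sum.cong refl) (simp add: sum_list_triv)
  also have "\<dots> = length (epart lam)"
    using PPhiD(3)[OF assms(1)] by (simp add: epart_def)
  finally show ?thesis .
qed

lemma has_type_carrier:
  assumes "has_type g lam"
  shows "g \<in> carrier_mat (pnorm lam) (pnorm lam)"
proof -
  from assms obtain bs where bs: "lam \<in> PPhi" "mset bs = block_mset lam" "similar_mat g (block_mat bs)"
    unfolding has_type_iff by blast
  show ?thesis
    using similar_mat_carrier[OF bs(3) block_mat_carrier[OF valid_blocksI[OF bs(1,2)]]]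
    unfolding sum_blocks_degree[OF bs(1,2)] .
qed

lemma card_fixset_has_type:
  fixes g :: "'a::{finite, field} mat"
  assumes "has_type g lam"
  shows "card (fixset g) = CARD('a) ^ length (epart lam)"
    "card (fixset (transpose_mat g)) = CARD('a) ^ length (epart lam)"
proof -
  from assms obtain bs where bs: "lam \<in> PPhi" "mset bs = block_mset lam" "similar_mat g (block_mat bs)"
    unfolding has_type_iff by blast
  note c = card_fixset_block_mat[OF valid_blocksI[OF bs(1,2)], unfolded sum_blocks_e[OF bs(1,2)]]
  show "card (fixset g) = CARD('a) ^ length (epart lam)"
    using card_fixset_similar[OF bs(3)] c(1) by simp
  show "card (fixset (transpose_mat g)) = CARD('a) ^ length (epart lam)"
    using card_fixset_similar[OF similar_mat_transpose[OF bs(3)]] c(2) by simp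
qed

text \<open>\<open>modify\<close> may empty the partition at t - 1 and so change the support; norms
  before and after are compared over a common index set.\<close>

lemma pnorm_superset:
  assumes "finite S" "{f. lam f \<noteq> []} \<subseteq> S"
  shows "pnorm lam = (\<Sum>f\<in>S. degree f * sum_list (lam f))"
  unfolding pnorm_def by (rule sum.mono_neutral_left) (use assms in auto)

text \<open>Deletion of the first column of the Young diagram.\<close>

definition lower :: "nat list \<Rightarrow> nat list" where
  "lower xs = filter (\<lambda>x. 0 < x) (map (\<lambda>x. x - 1) xs)"

lemma modify_alt: "modify lam f = (if f = [:-1, 1:] then lower (lam f) else lam f)"
  by (simp add: modify_def lower_def)

lemma sum_list_lower: "\<forall>x\<in>set xs. 0 < x \<Longrightarrow> sum_list (lower xs) + length xs = sum_list xs"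
  by (induction xs) (auto simp: lower_def)

lemma lower_append: "lower (xs @ ys) = lower xs @ lower ys"
  by (simp add: lower_def)

lemma lower_replicate_1: "lower (replicate k (Suc 0)) = []"
  by (simp add: lower_def)

lemma lower_map_Suc: "\<forall>x\<in>set xs. 0 < x \<Longrightarrow> lower (map Suc xs) = xs"
  by (induction xs) (auto simp: lower_def)

text \<open>The deleted column has one box for each part at t - 1, and a box there has weight 1
  because t - 1 is linear.\<close>

lemma pnorm_modify:
  assumes "lam \<in> PPhi"
  shows "pnorm lam = pnorm (modify lam) + length (epart lam)"
proof -
  let ?S = "insert [:-1, 1:] {f. lam f \<noteq> []}"
  have fin: "finite ?S" using PPhiD(3)[OF assms] by simp
  have sub: "{f. modify lam f \<noteq> []} \<subseteq> ?S" by (auto simp: modify_alt lower_def)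
  have summand: "degree f * sum_list (lam f) =
      degree f * sum_list (modify lam f) + (if f = [:-1, 1:] then length (lam f) else 0)" for f
    using sum_list_lower[of "lam f"] PPhiD(1)[OF assms, of f]
    by (auto simp: modify_alt is_partition_def)
  have "pnorm lam = (\<Sum>f\<in>?S. degree f * sum_list (lam f))"
    by (rule pnorm_superset[OF fin]) auto
  also have "\<dots> = (\<Sum>f\<in>?S. degree f * sum_list (modify lam f))
      + (\<Sum>f\<in>?S. if f = [:-1, 1:] then length (lam f) else 0)"
    unfolding summand sum.distrib ..
  also have "(\<Sum>f\<in>?S. if f = [:-1, 1:] then length (lam f) else 0) = length (epart lam)"
    using fin by (simp add: epart_def)
  also have "(\<Sum>f\<in>?S. degree f * sum_list (modify lam f)) = pnorm (modify lam)"
    by (rule pnorm_superset[OF fin sub, symmetric])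
  finally show ?thesis .
qed

text \<open>The size \<open>n\<close> is the norm of the full type. It exceeds
  \<open>pnorm mu\<close> by the number of parts at t - 1, which is the dimension of the fixed
  space. The product form avoids subtraction in the exponent.\<close>

lemma card_fixset_has_modtype:
  fixes g :: "'a::{finite, field} mat"
  assumes "has_modtype g mu" "g \<in> carrier_mat n n"
  shows "card (fixset g) * CARD('a) ^ pnorm mu = CARD('a) ^ n"
    "card (fixset (transpose_mat g)) * CARD('a) ^ pnorm mu = CARD('a) ^ n"
proof -
  from assms(1) obtain lam where lam: "has_type g lam" "modify lam = mu"
    by (auto simp: has_modtype_def)
  have "n = pnorm lam"
    using has_type_carrier[OF lam(1), THEN carrier_matD(1)] assms(2)[THEN carrier_matD(1)] by simp
  moreover have "lam \<in> PPhi" using lam(1) by (simp add: has_type_def)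
  ultimately have "n = pnorm mu + length (epart lam)"
    using pnorm_modify lam(2) by blast
  then show "card (fixset g) * CARD('a) ^ pnorm mu = CARD('a) ^ n"
    "card (fixset (transpose_mat g)) * CARD('a) ^ pnorm mu = CARD('a) ^ n"
    unfolding card_fixset_has_type[OF lam(1)] by (simp_all add: power_add)
qed

section \<open>Conjugacy of elements of equal modified type\<close>

lemma has_modtype_similar:
  assumes "similar_mat g h" "has_modtype h mu"
  shows "has_modtype g mu"
proof -
  obtain lam bs where "modify lam = mu" "lam \<in> PPhi" "mset bs = block_mset lam" "similar_mat h (block_mat bs)"
    using assms(2) unfolding has_modtype_def has_type_iff by blast
  moreover from this(4) have "similar_mat g (block_mat bs)" by (rule similar_mat_trans[OF assms(1)])
  ultimately show ?thesis unfolding has_modtype_def has_type_iff by blast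
qed

text \<open>The parts lost by \<open>lower\<close> are those equal to 1, and they stand at the end
  of a decreasing list. Hence the shortened partition and the number of parts determine the
  original.\<close>

lemma partition_lower:
  assumes "is_partition xs"
  shows "xs = map Suc (lower xs) @ replicate (length xs - length (lower xs)) 1"
  using assms
proof (induction xs)
  case (Cons x xs)
  then have part: "is_partition xs" and x: "0 < x" "\<forall>y\<in>set xs. 0 < y \<and> y \<le> x"
    by (auto simp: is_partition_def)
  show ?case
  proof (cases "x = 1")
    case True
    then have "\<forall>y\<in>set (x # xs). y = 1" using x by force
    then have "x # xs = replicate (length (x # xs)) 1" by (metis replicate_length_same)
    then show ?thesis by (metis One_nat_def append_Nil diff_zero list.map(1) list.size(3) lower_replicate_1)
  next
    case False
    then have "lower (x # xs) = (x - 1) # lower xs" using x by (simp add: lower_def)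
    then show ?thesis using Cons.IH[OF part] x by simp
  qed
qed (simp add: lower_def)

text \<open>The gap between the norms of the type and the modified type is the number of parts at t
  - 1, exactly the datum needed to restore the deleted column.\<close>

lemma modify_inject:
  assumes lam: "lam \<in> PPhi" and lam': "lam' \<in> PPhi"
    and eq: "modify lam = modify lam'" "pnorm lam = pnorm lam'"
  shows "lam = lam'"
proof
  fix f
  have len: "length (epart lam) = length (epart lam')"
    using pnorm_modify[OF lam] pnorm_modify[OF lam'] eq by simp
  have m: "modify lam f = modify lam' f" using eq(1) by simp
  show "lam f = lam' f"
  proof (cases "f = [:-1, 1:]")
    case True
    then have "lower (lam f) = lower (lam' f)" using m by (simp add: modify_alt)
    moreover have "length (lam f) = length (lam' f)" using len True by (simp add: epart_def)
    ultimately show ?thesis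
      using partition_lower[OF PPhiD(1)[OF lam]] partition_lower[OF PPhiD(1)[OF lam']] by metis
  next
    case False
    then show ?thesis using m by (simp add: modify_alt)
  qed
qed

text \<open>The norm of either full type is the common size \<open>n\<close>, so the types agree;
  the block matrices then differ only in the order of their blocks.\<close>

lemma has_modtype_imp_similar:
  assumes "has_modtype x nu" "has_modtype y nu" "x \<in> carrier_mat n n" "y \<in> carrier_mat n n"
  shows "similar_mat x y"
proof -
  obtain lam where lam: "has_type x lam" "modify lam = nu" using assms(1) by (auto simp: has_modtype_def)
  obtain lam' where lam': "has_type y lam'" "modify lam' = nu" using assms(2) by (auto simp: has_modtype_def)
  obtain bs where bs: "lam \<in> PPhi" "mset bs = block_mset lam" "similar_mat x (block_mat bs)"
    using lam(1) unfolding has_type_iff by blast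
  obtain cs where cs: "lam' \<in> PPhi" "mset cs = block_mset lam'" "similar_mat y (block_mat cs)"
    using lam'(1) unfolding has_type_iff by blast
  have "pnorm lam = pnorm lam'"
    using has_type_carrier[OF lam(1), THEN carrier_matD(1)] has_type_carrier[OF lam'(1), THEN carrier_matD(1)]
      assms(3,4)[THEN carrier_matD(1)] by simp
  with lam(2) lam'(2) have "lam = lam'" by (intro modify_inject[OF bs(1) cs(1)]) simp_all
  then have "mset bs = mset cs" using bs(2) cs(2) by simp
  then have "similar_mat (block_mat bs) (block_mat cs)" by (rule similar_block_mat_perm)
  then show ?thesis by (rule similar_mat_trans[OF bs(3) similar_mat_trans[OF _ similar_mat_sym[OF cs(3)]]])
qed

section \<open>Adding and removing a part 1 at t - 1\<close>

lemma PPhi_upd_e: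
  assumes "lam \<in> PPhi" "is_partition xs"
  shows "lam([:-1, 1:] := xs) \<in> PPhi"
proof -
  have "{f. (lam([:-1, 1:] := xs)) f \<noteq> []} \<subseteq> insert [:-1, 1:] {f. lam f \<noteq> []}" by auto
  moreover have "finite (insert [:-1, 1:] {f. lam f \<noteq> []})" using PPhiD(3)[OF assms(1)] by simp
  ultimately have "finite {f. (lam([:-1, 1:] := xs)) f \<noteq> []}" by (rule finite_subset)
  then show ?thesis using assms e_in_Phi by (auto simp: PPhi_def)
qed

lemma is_partition_snoc_1: "is_partition (xs @ [Suc 0]) \<longleftrightarrow> is_partition xs"
  by (auto simp: is_partition_def sorted_wrt_append)

lemma block_mset_snoc_1:
  fixes lam :: "'a::field poly \<Rightarrow> nat list"
  assumes "lam \<in> PPhi" "lam [:-1, 1:] = xs @ [1]"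
  shows "block_mset lam = add_mset ([:-1, 1:], 1) (block_mset (lam([:-1, 1:] := xs)))"
proof (rule multiset_eqI)
  fix b :: "'a poly \<times> nat"
  obtain f k where b: "b = (f, k)" by fastforce
  have "is_partition xs"
    using PPhiD(1)[OF assms(1), of "[:-1, 1:]"] assms(2) is_partition_snoc_1 by simp
  from PPhi_upd_e[OF assms(1) this] have fin: "finite {f. (lam([:-1, 1:] := xs)) f \<noteq> []}"
    by (rule PPhiD(3))
  show "count (block_mset lam) b = count (add_mset ([:-1, 1:], 1) (block_mset (lam([:-1, 1:] := xs)))) b"
    unfolding b count_add_mset count_block_mset[OF PPhiD(3)[OF assms(1)]] count_block_mset[OF fin]
    using assms(2) by auto
qed

lemma unit_vec_in_fixset_dsum_one:
  fixes A :: "'a::field mat"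
  assumes A: "A \<in> carrier_mat n n"
  shows "unit_vec (Suc n) n \<in> fixset (dsum A (1\<^sub>m 1))"
proof -
  have "dsum A (1\<^sub>m 1) *\<^sub>v unit_vec (Suc n) n = unit_vec (Suc n) n"
  proof (rule eq_vecI)
    fix i assume "i < dim_vec (unit_vec (Suc n) n)"
    then show "(dsum A (1\<^sub>m 1) *\<^sub>v unit_vec (Suc n) n) $ i = unit_vec (Suc n) n $ i"
      using A by (auto simp: scalar_prod_right_unit[of n "Suc n"] dsum_def)
  qed (use A in simp)
  then show ?thesis using A by (simp add: fixset_def)
qed

lemma has_modtype_dsum_one:
  fixes x :: "'a::field mat"
  assumes x: "x \<in> carrier_mat n n"
  shows "has_modtype (dsum x (1\<^sub>m 1)) mu \<longleftrightarrow> has_modtype x mu"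
proof
  assume "has_modtype x mu"
  then obtain lam bs where lam: "modify lam = mu" "lam \<in> PPhi" "mset bs = block_mset lam"
      "similar_mat x (block_mat bs)"
    unfolding has_modtype_def has_type_iff by blast
  \<comment> \<open>The new summand is the companion block of t - 1 itself: a part 1, which
    \<open>modify\<close> discards.\<close>
  define lam' where "lam' = lam([:-1, 1:] := lam [:-1, 1:] @ [1])"
  have "lam' \<in> PPhi"
    unfolding lam'_def using lam(2) PPhiD(1)[OF lam(2)] by (intro PPhi_upd_e) (auto simp: is_partition_snoc_1)
  moreover have "mset (bs @ [([:-1, 1:], 1)]) = block_mset lam'"
    using block_mset_snoc_1[OF \<open>lam' \<in> PPhi\<close>, of "lam [:-1, 1:]"] lam(3) by (simp add: lam'_def)
  moreover have "similar_mat (dsum x (1\<^sub>m 1)) (block_mat (bs @ [([:-1, 1:], 1)]))"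
    unfolding block_mat_snoc by (rule similar_mat_dsum[OF lam(4) similar_mat_refl[OF one_carrier_mat] x one_carrier_mat])
  ultimately have "has_type (dsum x (1\<^sub>m 1)) lam'" unfolding has_type_iff by blast
  moreover have "modify lam' = mu"
    unfolding lam(1)[symmetric]
    by (rule ext) (simp add: modify_alt lam'_def lower_append lower_replicate_1[of 1, simplified])
  ultimately show "has_modtype (dsum x (1\<^sub>m 1)) mu" unfolding has_modtype_def by blast
next
  assume "has_modtype (dsum x (1\<^sub>m 1)) mu"
  then obtain lam bs where lam: "modify lam = mu" "lam \<in> PPhi" "mset bs = block_mset lam"
      "similar_mat (dsum x (1\<^sub>m 1)) (block_mat bs)"
    unfolding has_modtype_def has_type_iff by blast
  note valid = valid_blocksI[OF lam(2,3)]
  \<comment> \<open>The last unit vector is fixed both as a vector and as a covector, and its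
    pairing with itself is 1, so \<open>fix_orthogonal\<close> fails.\<close>
  have "([:-1, 1:], 1) \<in> set bs"
  proof (rule ccontr)
    assume "([:-1, 1:], 1) \<notin> set bs"
    then have orth: "fix_orthogonal (dsum x (1\<^sub>m 1))"
      using fix_orthogonal_similar[OF lam(4)] fix_orthogonal_block_mat[OF valid] by blast
    let ?u = "unit_vec (Suc n) n :: 'a vec"
    have "?u \<in> fixset (transpose_mat (dsum x (1\<^sub>m 1)))"
      unfolding transpose_dsum[OF x one_carrier_mat] transpose_one
      by (rule unit_vec_in_fixset_dsum_one) (use x in simp)
    with orth unit_vec_in_fixset_dsum_one[OF x] have "?u \<bullet> ?u = 0"
      unfolding fix_orthogonal_def by blast
    then show False by (simp add: scalar_prod_right_unit[of n "Suc n"])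
  qed
  then have "1 \<in> set (lam [:-1, 1:])" using set_blocks[OF lam(2,3)] by simp
  moreover have part: "is_partition (lam [:-1, 1:])" by (rule PPhiD(1)[OF lam(2)])
  \<comment> \<open>Parts are positive and decreasing, so if a part 1 occurs, the last part is
    1.\<close>
  ultimately have "\<exists>xs. lam [:-1, 1:] = xs @ [1]"
  proof (cases "lam [:-1, 1:]" rule: rev_cases)
    case (snoc ys y)
    then have "\<forall>z\<in>set ys. y \<le> z" "0 < y" using part by (auto simp: is_partition_def sorted_wrt_append)
    moreover have "1 \<in> set ys \<or> y = 1" using \<open>1 \<in> set (lam [:-1, 1:])\<close> snoc by auto
    ultimately have "y = 1" by force
    then show ?thesis using snoc by blast
  qed simp
  then obtain xs where xs: "lam [:-1, 1:] = xs @ [1]" by blast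
  define lam' where "lam' = lam([:-1, 1:] := xs)"
  have lam': "lam' \<in> PPhi"
    unfolding lam'_def using part xs by (intro PPhi_upd_e[OF lam(2)]) (simp add: is_partition_snoc_1)
  obtain cs where cs: "mset cs = block_mset lam'" using ex_mset by blast
  \<comment> \<open>Reordering moves the trivial block to the end, where it can be cancelled against
    the summand 1.\<close>
  have ms: "mset bs = mset (cs @ [([:-1, 1:], 1)])"
    using block_mset_snoc_1[OF lam(2) xs] cs lam(3) by (simp add: lam'_def)
  have sim: "similar_mat (dsum x (1\<^sub>m 1)) (dsum (block_mat cs) (1\<^sub>m 1))"
    using similar_mat_trans[OF lam(4) similar_block_mat_perm[OF ms]] unfolding block_mat_snoc .
  obtain m where m: "block_mat cs \<in> carrier_mat m m"
    using block_mat_carrier[OF valid_blocksI[OF lam' cs]] by blast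
  have "dsum x (1\<^sub>m 1) \<in> carrier_mat (m + 1) (m + 1)"
    by (rule similar_mat_carrier[OF sim dsum_carrier[OF m one_carrier_mat]])
  then have "dim_row x + 1 = m + 1" by (metis carrier_matD(1) dim_dsum(1) index_one_mat(2))
  then have "m = n" using x by simp
  then have "similar_mat x (block_mat cs)"
    using similar_mat_dsum_one_cancel[OF x _ sim] m by blast
  then have "has_type x lam'" unfolding has_type_iff using lam' cs by blast
  moreover have "modify lam' = mu"
    unfolding lam(1)[symmetric]
    by (rule ext) (simp add: modify_alt lam'_def xs lower_append lower_replicate_1[of 1, simplified])
  ultimately show "has_modtype x mu" unfolding has_modtype_def by blast
qed

text \<open>This guarantees that the choice in \<open>struct_const\<close> selects an element of the
  class. A full type arises from \<open>nu\<close> by putting a new first column on the diagram at t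
  - 1.\<close>

lemma ex_has_modtype:
  fixes nu :: "'a::field poly \<Rightarrow> nat list"
  assumes nu: "nu \<in> PPhi" and n: "pnorm nu + length (epart nu) \<le> n"
  shows "\<exists>z\<in>GL n. has_modtype z nu"
proof -
  \<comment> \<open>The new column has \<open>length (epart nu) + k\<close> boxes. The bound on
    \<open>n\<close> makes the subtraction exact, so the resulting norm is \<open>n\<close>.\<close>
  define k where "k = n - (pnorm nu + length (epart nu))"
  define xs where "xs = map Suc (nu [:-1, 1:]) @ replicate k (Suc 0)"
  define lam where "lam = nu([:-1, 1:] := xs)"
  have part: "is_partition (nu [:-1, 1:])" by (rule PPhiD(1)[OF nu])
  moreover have "sorted_wrt (\<ge>) (replicate k (Suc 0))" by (induction k) auto
  ultimately have "is_partition xs"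
    by (auto simp: is_partition_def xs_def sorted_wrt_append sorted_wrt_map)
  then have lam: "lam \<in> PPhi" unfolding lam_def by (rule PPhi_upd_e[OF nu])
  have mod: "modify lam = nu"
  proof
    fix f show "modify lam f = nu f"
      using part by (simp add: modify_alt lam_def xs_def lower_append lower_replicate_1 lower_map_Suc is_partition_def)
  qed
  have "length (epart lam) = length (epart nu) + k" by (simp add: epart_def lam_def xs_def)
  then have pn: "pnorm lam = n" using pnorm_modify[OF lam] n unfolding mod k_def by simp
  obtain bs where bs: "mset bs = block_mset lam" using ex_mset by blast
  note valid = valid_blocksI[OF lam bs]
  note carr = block_mat_carrier[OF valid, unfolded sum_blocks_degree[OF lam bs] pn]
  have "has_type (block_mat bs) lam"
    unfolding has_type_iff using lam bs similar_mat_refl[OF carr] by blast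
  then have "has_modtype (block_mat bs) nu" unfolding has_modtype_def using mod by blast
  moreover have "block_mat bs \<in> GL n" using carr det_block_mat[OF valid] by (simp add: GL_def)
  ultimately show ?thesis by blast
qed

section \<open>Stability of the structure constants\<close>

text \<open>Fixing the unit vector prescribes the last column, and fixing it under the transpose
  prescribes the last row.\<close>

lemma dsum_one_if_unit_vec_fixed:
  fixes x :: "'a::field mat"
  assumes x: "x \<in> carrier_mat (Suc n) (Suc n)"
    and fixed: "unit_vec (Suc n) n \<in> fixset x" "unit_vec (Suc n) n \<in> fixset (transpose_mat x)"
  shows "\<exists>x0\<in>carrier_mat n n. x = dsum x0 (1\<^sub>m 1)"
proof -
  let ?u = "unit_vec (Suc n) n :: 'a vec"
  have col: "x $$ (i, n) = ?u $ i" if "i < Suc n" for i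
  proof -
    have "x *\<^sub>v ?u = ?u" using fixed(1) by (simp add: fixset_def)
    then have "(x *\<^sub>v ?u) $ i = ?u $ i" by (rule arg_cong)
    then show ?thesis using x that by simp
  qed
  have row: "x $$ (n, j) = ?u $ j" if "j < Suc n" for j
  proof -
    have "transpose_mat x *\<^sub>v ?u = ?u" using fixed(2) by (simp add: fixset_def)
    then have "(transpose_mat x *\<^sub>v ?u) $ j = ?u $ j" by (rule arg_cong)
    then show ?thesis using x that by simp
  qed
  define x0 where "x0 = mat n n (\<lambda>ij. x $$ ij)"
  have "x = dsum x0 (1\<^sub>m 1)"
  proof (rule eq_matI)
    fix i j assume "i < dim_row (dsum x0 (1\<^sub>m 1 :: 'a mat))" "j < dim_col (dsum x0 (1\<^sub>m 1 :: 'a mat))"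
    then have ij: "i < Suc n" "j < Suc n" by (simp_all add: x0_def)
    show "x $$ (i, j) = dsum x0 (1\<^sub>m 1) $$ (i, j)"
    proof (cases "i = n \<or> j = n")
      case True
      then show ?thesis using col[OF ij(1)] row[OF ij(2)] ij by (auto simp: dsum_def x0_def)
    next
      case False
      then show ?thesis using ij by (simp add: dsum_def x0_def)
    qed
  qed (use x in \<open>simp_all add: x0_def\<close>)
  moreover have "x0 \<in> carrier_mat n n" by (simp add: x0_def)
  ultimately show ?thesis by blast
qed

text \<open>The codimensions of the fixed spaces of \<open>x\<close> and \<open>y\<close> add up to that of \<open>x y\<close>, so
  every vector fixed by \<open>x y\<close> is fixed by both factors; the same holds for the transposes.\<close>
lemma factors_dsum_one:
  fixes x y z :: "'a::{finite, field} mat"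
  assumes x: "x \<in> carrier_mat (Suc n) (Suc n)" "has_modtype x lam"
    and y: "y \<in> carrier_mat (Suc n) (Suc n)" "has_modtype y mu"
    and z: "z \<in> carrier_mat n n" "has_modtype z nu"
    and xy: "x * y = dsum z (1\<^sub>m 1)" and norm: "pnorm nu = pnorm lam + pnorm mu"
  shows "(\<exists>x0\<in>carrier_mat n n. x = dsum x0 (1\<^sub>m 1)) \<and> (\<exists>y0\<in>carrier_mat n n. y = dsum y0 (1\<^sub>m 1))"
proof -
  let ?u = "unit_vec (Suc n) n :: 'a vec"
  have xy_carr: "x * y \<in> carrier_mat (Suc n) (Suc n)" using x(1) y(1) by simp
  have xy_mod: "has_modtype (x * y) nu" unfolding xy using z has_modtype_dsum_one by blast
  \<comment> \<open>Multiplying by \<open>CARD('a) ^ pnorm nu\<close> turns additivity of the norms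
    into the cardinality hypothesis of \<open>fixset_mult_subset\<close>; this positive factor is
    then cancelled.\<close>
  have prod: "a * b = c * CARD('a) ^ Suc n"
    if a: "a * CARD('a) ^ pnorm lam = CARD('a) ^ Suc n" and b: "b * CARD('a) ^ pnorm mu = CARD('a) ^ Suc n"
      and c: "c * CARD('a) ^ pnorm nu = CARD('a) ^ Suc n" for a b c :: nat
  proof -
    have "a * b * CARD('a) ^ pnorm nu = (a * CARD('a) ^ pnorm lam) * (b * CARD('a) ^ pnorm mu)"
      by (simp add: norm power_add)
    also have "\<dots> = c * CARD('a) ^ Suc n * CARD('a) ^ pnorm nu" unfolding a b using c by simp
    finally show ?thesis by simp
  qed
  note cx = card_fixset_has_modtype[OF x(2,1)]
  note cy = card_fixset_has_modtype[OF y(2,1)]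
  note cxy = card_fixset_has_modtype[OF xy_mod xy_carr]
  have tr: "transpose_mat (x * y) = transpose_mat y * transpose_mat x"
    by (rule transpose_mult[OF x(1) y(1)])
  have "?u \<in> fixset (x * y)" unfolding xy by (rule unit_vec_in_fixset_dsum_one[OF z(1)])
  then have 1: "?u \<in> fixset x" "?u \<in> fixset y"
    using fixset_mult_subset[OF x(1) y(1) prod[OF cx(1) cy(1) cxy(1)]] by blast+
  have "transpose_mat z \<in> carrier_mat n n" using z(1) by simp
  then have "?u \<in> fixset (transpose_mat (x * y))"
    unfolding xy transpose_dsum[OF z(1) one_carrier_mat] transpose_one
    by (rule unit_vec_in_fixset_dsum_one)
  moreover have "fixset (transpose_mat y * transpose_mat x) \<subseteq> fixset (transpose_mat y) \<inter> fixset (transpose_mat x)"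
    using prod[OF cx(2) cy(2) cxy(2)] x(1) y(1) unfolding tr
    by (intro fixset_mult_subset[of _ "Suc n"]) (simp_all add: mult.commute)
  ultimately have 2: "?u \<in> fixset (transpose_mat x)" "?u \<in> fixset (transpose_mat y)"
    unfolding tr by blast+
  show ?thesis
    using dsum_one_if_unit_vec_fixed[OF x(1) 1(1) 2(1)] dsum_one_if_unit_vec_fixed[OF y(1) 1(2) 2(2)] ..
qed

text \<open>Conjugating both factors simultaneously is a bijection between the factorizations of
  \<open>z\<close> and those of \<open>z'\<close>, and class sums are constant under
  conjugation.\<close>

lemma gr_mult_class_sum_similar:
  fixes z z' :: "'a::field mat"
  assumes sim: "similar_mat z z'" and z': "z' \<in> carrier_mat n n"
  shows "gr_mult n (class_sum lam n) (class_sum mu n) z = gr_mult n (class_sum lam n) (class_sum mu n) z'"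
proof -
  have z: "z \<in> carrier_mat n n" by (rule similar_mat_carrier[OF sim z'])
  obtain P Q where wit: "similar_mat_wit z z' P Q" using sim unfolding similar_mat_def by blast
  note PQ = similar_mat_witD2[OF z wit]
  \<comment> \<open>Stated for an arbitrary pair of inverse matrices, so that it serves both
    directions of the bijection.\<close>
  have conj: "P' * x * Q' \<in> GL n \<and> similar_mat (P' * x * Q') x \<and> Q' * (P' * x * Q') * P' = x
      \<and> P' * (x * y) * Q' = (P' * x * Q') * (P' * y * Q')"
    if "P' \<in> carrier_mat n n" "Q' \<in> carrier_mat n n" "P' * Q' = 1\<^sub>m n" "Q' * P' = 1\<^sub>m n" "x \<in> GL n" "y \<in> GL n"
    for P' Q' x y :: "'a mat"
  proof -
    have x: "x \<in> carrier_mat n n" and y: "y \<in> carrier_mat n n" using that(5,6) by (auto simp: GL_def)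
    have sim: "similar_mat (P' * x * Q') x"
      by (rule similar_matI[OF _ that(3,4) refl]) (use x that(1,2) in simp)
    have "P' * x * Q' \<in> GL n"
      using det_similar[OF sim] that(1,2,5) x by (simp add: GL_def)
    moreover have "Q' * (P' * x * Q') * P' = (Q' * P') * x * (Q' * P')"
      using that(1,2) x by (simp add: assoc_mult_mat[of _ n n _ n _ n])
    moreover have "P' * (x * y) * Q' = P' * x * (Q' * P') * y * Q'"
      using that(1,2) x y unfolding that(4) by (simp add: assoc_mult_mat[of _ n n _ n _ n])
    moreover have "\<dots> = (P' * x * Q') * (P' * y * Q')"
      using that(1,2) x y by (simp add: assoc_mult_mat[of _ n n _ n _ n])
    ultimately show ?thesis using sim that(4) x by simp
  qed
  note c1 = conj[OF PQ(6,7,1,2)] and c2 = conj[OF PQ(7,6,2,1)]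
  have zz': "Q * z * P = z'"
  proof -
    have "Q * z * P = (Q * P) * z' * (Q * P)"
      unfolding PQ(3) using PQ(6,7) z' by (simp add: assoc_mult_mat[of _ n n _ n _ n])
    then show ?thesis using PQ(2) z' by simp
  qed
  have cs: "class_sum rho n h = class_sum rho n g"
    if "similar_mat g h" "g \<in> GL n" "h \<in> GL n" for g h and rho :: "'a poly \<Rightarrow> nat list"
    using that has_modtype_similar[OF that(1)] has_modtype_similar[OF similar_mat_sym[OF that(1)]]
    by (auto simp: class_sum_def)
  show ?thesis
    unfolding gr_mult_def
  proof (rule sum.reindex_bij_witness[of _ "\<lambda>(x, y). (P * x * Q, P * y * Q)" "\<lambda>(x, y). (Q * x * P, Q * y * P)"], goal_cases)
    case (1 a)
    then show ?case using c2 by auto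
  next
    case (2 a)
    then obtain x y where a: "a = (x, y)" "x \<in> GL n" "y \<in> GL n" "x * y = z" by auto
    have "Q * x * P * (Q * y * P) = z'" using c2[OF a(2,3)] a(4) zz' by simp
    then show ?case using c2[OF a(2,3)] c2[OF a(3,2)] by (simp add: a(1))
  next
    case (3 b)
    then show ?case using c1 by auto
  next
    case (4 b)
    then obtain x y where b: "b = (x, y)" "x \<in> GL n" "y \<in> GL n" "x * y = z'" by auto
    have "P * x * Q * (P * y * Q) = z" using c1[OF b(2,3)] b(4) PQ(3) by simp
    then show ?case using c1[OF b(2,3)] c1[OF b(3,2)] by (simp add: b(1))
  next
    case (5 a)
    then obtain x y where a: "a = (x, y)" "x \<in> GL n" "y \<in> GL n" by auto
    have "class_sum lam n x = class_sum lam n (Q * x * P)" "class_sum mu n y = class_sum mu n (Q * y * P)"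
      using c2[OF a(2,3)] c2[OF a(3,2)] a by (auto intro!: cs)
    then show ?case by (simp add: a(1))
  qed
qed

lemma class_sum_dsum_one:
  assumes "x \<in> carrier_mat n n"
  shows "class_sum lam (Suc n) (dsum x (1\<^sub>m 1)) = class_sum lam n x"
  unfolding class_sum_def GL_dsum_one[OF assms] has_modtype_dsum_one[OF assms] ..

text \<open>Adding the summand 1 to both factors embeds the factorizations of \<open>z\<close> into
  those of \<open>dsum z (1\<^sub>m 1)\<close> and preserves their weights. Factorizations outside
  the image contribute zero.\<close>

lemma gr_mult_class_sum_dsum_one:
  fixes z :: "'a::{finite, field} mat"
  assumes z: "z \<in> carrier_mat n n" "has_modtype z nu" and norm: "pnorm nu = pnorm lam + pnorm mu"
  shows "gr_mult (Suc n) (class_sum lam (Suc n)) (class_sum mu (Suc n)) (dsum z (1\<^sub>m 1)) =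
    gr_mult n (class_sum lam n) (class_sum mu n) z"
proof -
  let ?S = "\<lambda>n z. {(x, y). x \<in> GL n \<and> y \<in> GL n \<and> x * y = (z :: 'a mat)}"
  let ?h = "\<lambda>(x, y). (dsum x (1\<^sub>m 1), dsum y (1\<^sub>m 1)) :: 'a mat \<times> 'a mat"
  let ?X = "class_sum lam" and ?Y = "class_sum mu"
  have carr: "x \<in> carrier_mat n n" if "x \<in> GL n" for x :: "'a mat" using that by (simp add: GL_def)
  have mult: "dsum x (1\<^sub>m 1) * dsum y (1\<^sub>m 1) = dsum (x * y) (1\<^sub>m 1)"
    if "x \<in> carrier_mat n n" "y \<in> carrier_mat n n" for x y :: "'a mat"
    using dsum_mult[OF that(1) one_carrier_mat that(2) one_carrier_mat, of 1] by simp
  have inj: "x = y" if "dsum x (1\<^sub>m 1) = dsum y (1\<^sub>m 1)" "x \<in> carrier_mat n n" "y \<in> carrier_mat n n"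
    for x y :: "'a mat"
    by (rule dsum_inject[OF that one_carrier_mat one_carrier_mat])
  have "?S (Suc n) (dsum z (1\<^sub>m 1)) \<subseteq> GL (Suc n) \<times> GL (Suc n)" by auto
  then have fin: "finite (?S (Suc n) (dsum z (1\<^sub>m 1)))"
    by (rule finite_subset) (intro finite_cartesian_product finite_GL)
  have "inj_on ?h (?S n z)"
    by (rule inj_onI) (use inj carr in \<open>auto\<close>)
  then have "(\<Sum>(x, y)\<in>?h ` ?S n z. ?X (Suc n) x * ?Y (Suc n) y) =
      (\<Sum>p\<in>?S n z. case ?h p of (x, y) \<Rightarrow> ?X (Suc n) x * ?Y (Suc n) y)"
    by (simp only: sum.reindex o_def)
  also have "\<dots> = (\<Sum>(x, y)\<in>?S n z. ?X n x * ?Y n y)"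
    by (intro sum.cong refl) (use carr in \<open>auto simp: class_sum_dsum_one[simplified]\<close>)
  also have "(\<Sum>(x, y)\<in>?h ` ?S n z. ?X (Suc n) x * ?Y (Suc n) y) =
      (\<Sum>(x, y)\<in>?S (Suc n) (dsum z (1\<^sub>m 1)). ?X (Suc n) x * ?Y (Suc n) y)"
  proof (rule sum.mono_neutral_left[OF fin])
    show "?h ` ?S n z \<subseteq> ?S (Suc n) (dsum z (1\<^sub>m 1))"
    proof (rule image_subsetI)
      fix p assume "p \<in> ?S n z"
      then obtain x y where p: "p = (x, y)" "x \<in> GL n" "y \<in> GL n" "x * y = z" by auto
      then show "?h p \<in> ?S (Suc n) (dsum z (1\<^sub>m 1))"
        using mult[OF p(2,3)[THEN carr]] GL_dsum_one[OF carr[OF p(2)]] GL_dsum_one[OF carr[OF p(3)]] by simp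
    qed
    show "\<forall>p\<in>?S (Suc n) (dsum z (1\<^sub>m 1)) - ?h ` ?S n z.
        (case p of (x, y) \<Rightarrow> ?X (Suc n) x * ?Y (Suc n) y) = 0"
    \<comment> \<open>A nonzero weight means that the factors have modified types \<open>lam\<close>
      and \<open>mu\<close>; additivity of the norms then splits the summand 1 off both of
      them.\<close>
    proof (rule ballI, rule ccontr)
      fix p assume p: "p \<in> ?S (Suc n) (dsum z (1\<^sub>m 1)) - ?h ` ?S n z"
        and nz: "(case p of (x, y) \<Rightarrow> ?X (Suc n) x * ?Y (Suc n) y) \<noteq> 0"
      from p obtain x y where xy: "p = (x, y)" "x \<in> GL (Suc n)" "y \<in> GL (Suc n)" "x * y = dsum z (1\<^sub>m 1)"
        by auto
      from nz have mod: "has_modtype x lam" "has_modtype y mu"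
        by (auto simp: xy(1) class_sum_def split: if_splits)
      have c: "x \<in> carrier_mat (Suc n) (Suc n)" "y \<in> carrier_mat (Suc n) (Suc n)"
        using xy(2,3) by (simp_all add: GL_def)
      from factors_dsum_one[OF c(1) mod(1) c(2) mod(2) z xy(4) norm]
      obtain x0 y0 where x0: "x0 \<in> carrier_mat n n" "x = dsum x0 (1\<^sub>m 1)"
        and y0: "y0 \<in> carrier_mat n n" "y = dsum y0 (1\<^sub>m 1)" by blast
      have "x0 * y0 = z"
      proof (rule inj)
        show "dsum (x0 * y0) (1\<^sub>m 1) = dsum z (1\<^sub>m 1)"
          using mult[OF x0(1) y0(1)] xy(4) x0(2) y0(2) by simp
      qed (use x0(1) y0(1) z(1) in simp_all)
      then have "(x0, y0) \<in> ?S n z"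
        using xy(2,3) GL_dsum_one[OF x0(1)] GL_dsum_one[OF y0(1)] x0(2) y0(2) by simp
      then have "p \<in> ?h ` ?S n z" by (rule rev_image_eqI) (simp add: xy(1) x0(2) y0(2))
      with p show False by blast
    qed
  qed
  finally show ?thesis by (simp only: gr_mult_def)
qed

text \<open>Replaces the chosen representative by any convenient one, so that \<open>z\<close> can
  be used at \<open>n\<close> and its sum with 1 at \<open>n + 1\<close>.\<close>

lemma struct_const_eq:
  fixes z :: "'a::{finite, field} mat"
  assumes z: "z \<in> GL n" "has_modtype z nu"
  shows "struct_const lam mu nu n = gr_mult n (class_sum lam n) (class_sum mu n) z"
proof -
  define w where "w = (SOME z. z \<in> GL n \<and> has_modtype z nu)"
  have w: "w \<in> GL n" "has_modtype w nu"
    using someI[of "\<lambda>z. z \<in> GL n \<and> has_modtype z nu" z] z unfolding w_def by blast+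
  have carr: "w \<in> carrier_mat n n" "z \<in> carrier_mat n n" using w(1) z(1) by (simp_all add: GL_def)
  show ?thesis
    unfolding struct_const_def w_def[symmetric]
    by (rule gr_mult_class_sum_similar[OF has_modtype_imp_similar[OF w(2) z(2) carr] carr(2)])
qed

theorem theorem3p4:
  fixes lam mu nu :: "'a::{finite, field} poly \<Rightarrow> nat list"
  assumes "lam \<in> PPhi" and "mu \<in> PPhi" and "nu \<in> PPhi"
    and "pnorm nu = pnorm lam + pnorm mu"
  shows "\<exists>c::int. 0 \<le> c \<and>
           (\<forall>n. pnorm nu + length (epart nu) \<le> n \<longrightarrow> struct_const lam mu nu n = c)"
proof -
  let ?n0 = "pnorm nu + length (epart nu)"
  have step: "struct_const lam mu nu (Suc n) = struct_const lam mu nu n" if n: "?n0 \<le> n" for n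
  proof -
    obtain z where z: "z \<in> GL n" "has_modtype z nu" using ex_has_modtype[OF assms(3) n] by blast
    have carr: "z \<in> carrier_mat n n" using z(1) by (simp add: GL_def)
    have "dsum z (1\<^sub>m 1) \<in> GL (Suc n)" "has_modtype (dsum z (1\<^sub>m 1)) nu"
      using z GL_dsum_one[OF carr] has_modtype_dsum_one[OF carr] by blast+
    then show ?thesis
      unfolding struct_const_eq[OF z]
      by (simp only: struct_const_eq gr_mult_class_sum_dsum_one[OF carr z(2) assms(4)])
  qed
  have "struct_const lam mu nu n = struct_const lam mu nu ?n0" if "?n0 \<le> n" for n
    using that by (induction n rule: dec_induct) (simp_all add: step)
  moreover have "0 \<le> struct_const lam mu nu ?n0"
    unfolding struct_const_def gr_mult_def by (rule sum_nonneg) (auto simp: class_sum_def)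
  ultimately show ?thesis by blast
qed

end
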